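(* Let $D\ge2$ be a fixed integer and let $m$ be a fixed positive integer. The asymptotic probability (as $n\to\infty$) that a uniformly random graph encoded manifold (GEM) $g\in\mathcal{GEM}=\mathcal{GEM}(D)$ of dimension $D$ and size $2n$ has $m$ connected components satisfies $$\mathbb P(g\text{ has }m\text{ connected components})\approx\sum_{k\ge0}\mathfrak d_{2k,m}(\mathcal{GEM})\cdot\binom{2n}{2k}\cdot\left(\frac{(2(n-k)-1)!!}{(2n-1)!!}\right)^{D+1},$$ where $$\begin{aligned}\mathfrak d_{k,m}(\mathcal{GEM})&=\#\{(g',g'')\in\mathcal{GEM}_i\cdot\mathcal{GEM}_{k-i}\mid0\le i\le k,\ \pi_0(g')=m-1,\ \pi_0(g'')\text{ is even}\}\\&\quad-\#\{(g',g'')\in\mathcal{GEM}_i\cdot\mathcal{GEM}_{k-i}\mid0\le i\le k,\ \pi_0(g')=m-1,\ \pi_0(g'')\text{ is odd}\}\end{aligned}$$ and $\pi_0(g)$ is the number of connected components of the GEM $g$.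
   Context: A GEM of dimension $D$ and size $N$ is obtained from $N$ simplices of dimension $D$ labeled by $[N]=\{1,\dots,N\}$ (or any set of size $N$), each with vertices labeled $1,\dots,D+1$, by choosing perfect matchings $\alpha_1,\dots,\alpha_{D+1}$ of the set of simplices and gluing, for each $i$ and $k$, the hyperface opposite to the $k$th vertex of the $i$th simplex to the hyperface opposite to the $k$th vertex of the $\alpha_k(i)$th simplex. Equivalently, it is a $(D+1)$-regular (multi)graph on $N$ labeled vertices with edges colored by $[D+1]$ in which each vertex is incident to exactly one edge of each color, i.e. a $(D+1)$-tuple of perfect matchings of the label set. There are $((2n-1)!!)^{D+1}$ GEMs of size $2n$ and none of odd size (with $(-1)!!=1$; for size $0$ there is one, the empty GEM, with $0$ components). Connected components are those of this graph. $\mathcal{GEM}_i$ denotes GEMs of dimension $D$ and size $i$; $(g',g'')\in\mathcal{GEM}_i\cdot\mathcal{GEM}_{k-i}$ means an ordered pair such that, for some decomposition $[k]=U'\sqcup U''$ with $|U'|=i$, $|U''|=k-i$, $g'$ is a GEM labeled by $U'$ and $g''$ is a GEM labeled by $U''$ (all decompositions are counted). Notation $\approx$: $p_n\approx\sum_{k\ge0}c_kg_k(n)$ (here $g_k(n)=\binom{2n}{2k}\big((2(n-k)-1)!!/(2n-1)!!\big)^{D+1}$) means that $g_{k+1}(n)=o(g_k(n))$ for every $k$ and, for every integer $r\ge0$, $p_n=\sum_{k=0}^rc_kg_k(n)+O(g_{r+1}(n))$ as $n\to\infty$. *)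

theory Defs
  imports "HOL-Probability.Probability" "HOL-Library.Landau_Symbols" "HOL-Library.Disjoint_Sets"
begin

definition perfect_matchings :: "nat set \<Rightarrow> nat set set set" where
  "perfect_matchings U = {M. partition_on U M \<and> (\<forall>e\<in>M. card e = 2)}"

text \<open>A GEM is given by its set of simplices together with the list of the
  matchings \<open>\<alpha>\<^sub>1, \<dots>, \<alpha>\<^sub>D\<^sub>+\<^sub>1\<close>.\<close>

type_synonym gem = "nat set \<times> nat set set list"

definition gems :: "nat \<Rightarrow> nat set \<Rightarrow> gem set" where
  "gems D U = {U} \<times> {\<alpha>. length \<alpha> = D + 1 \<and> set \<alpha> \<subseteq> perfect_matchings U}"

abbreviation GEM :: "nat \<Rightarrow> nat \<Rightarrow> gem set" where
  "GEM D N \<equiv> gems D {1..N}"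

definition gem_adj :: "gem \<Rightarrow> (nat \<times> nat) set" where
  "gem_adj g = {(x, y). \<exists>M\<in>set (snd g). {x, y} \<in> M}"

definition gem_components :: "gem \<Rightarrow> nat set set" where
  "gem_components g = fst g // {(x, y). x \<in> fst g \<and> y \<in> fst g \<and> (x, y) \<in> (gem_adj g)\<^sup>*}"

definition \<pi>\<^sub>0 :: "gem \<Rightarrow> nat" where
  "\<pi>\<^sub>0 g = card (gem_components g)"

text \<open>Since a GEM carries its label set, a pair determines the decomposition, and so
  the cardinality of this set counts all decompositions.\<close>

definition gem_product :: "nat \<Rightarrow> nat \<Rightarrow> nat \<Rightarrow> (gem \<times> gem) set" where
  "gem_product D i j = {(g', g''). \<exists>U' U''. U' \<union> U'' = {1..i + j} \<and> U' \<inter> U'' = {} \<and>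
     card U' = i \<and> card U'' = j \<and> g' \<in> gems D U' \<and> g'' \<in> gems D U''}"

definition \<dd> :: "nat \<Rightarrow> nat \<Rightarrow> nat \<Rightarrow> int" where
  "\<dd> D k m =
     int (card {(g', g''). \<exists>i\<le>k. (g', g'') \<in> gem_product D i (k - i) \<and>
                             \<pi>\<^sub>0 g' = m - 1 \<and> even (\<pi>\<^sub>0 g'')}) -
     int (card {(g', g''). \<exists>i\<le>k. (g', g'') \<in> gem_product D i (k - i) \<and>
                             \<pi>\<^sub>0 g' = m - 1 \<and> odd (\<pi>\<^sub>0 g'')})"

text \<open>The value at \<open>0\<close> also covers the convention \<open>(-1)!! = 1\<close>, because
  \<open>2 * 0 - 1 = 0\<close> on the natural numbers.\<close>

fun double_fact :: "nat \<Rightarrow> nat" where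
  "double_fact 0 = 1"
| "double_fact (Suc 0) = 1"
| "double_fact (Suc (Suc n)) = Suc (Suc n) * double_fact n"

definition gem_scale :: "nat \<Rightarrow> nat \<Rightarrow> nat \<Rightarrow> real" where
  "gem_scale D k n = real ((2 * n) choose (2 * k)) *
     (real (double_fact (2 * (n - k) - 1)) / real (double_fact (2 * n - 1))) ^ (D + 1)"

definition asymptotic_expansion ::
    "(nat \<Rightarrow> real) \<Rightarrow> (nat \<Rightarrow> real) \<Rightarrow> (nat \<Rightarrow> nat \<Rightarrow> real) \<Rightarrow> bool" where
  "asymptotic_expansion p c g \<longleftrightarrow>
     (\<forall>k. g (Suc k) \<in> o(g k)) \<and>
     (\<forall>r. (\<lambda>n. p n - (\<Sum>k\<le>r. c k * g k n)) \<in> O(g (Suc r)))"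

text \<open>The next two lemmas are the side conditions under which \<^const>\<open>pmf_of_set\<close>
  is the uniform distribution on \<open>GEM D (2 * n)\<close>.\<close>

lemma finite_gems:
  assumes "finite U"
  shows "finite (gems D U)"
proof -
  have "perfect_matchings U \<subseteq> Pow (Pow U)"
    by (auto simp: perfect_matchings_def partition_on_def)
  hence "finite (perfect_matchings U)"
    using assms by (meson finite_Pow_iff finite_subset)
  from finite_lists_length_eq[OF this, of "D + 1"] show ?thesis
    by (simp add: gems_def conj_commute)
qed

lemma GEM_nonempty: "GEM D (2 * n) \<noteq> {}"
proof -
  have "\<exists>M. M \<in> perfect_matchings {1..2 * n}"
  proof (induction n)
    case 0
    show ?case by (auto simp: perfect_matchings_def partition_on_def)
  next
    case (Suc n)
    then obtain M where M: "partition_on {1..2 * n} M" "\<forall>e\<in>M. card e = 2"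
      by (auto simp: perfect_matchings_def)
    have eq: "{1..2 * Suc n} = {2 * n + 1, 2 * n + 2} \<union> {1..2 * n}"
      by auto
    have "partition_on {1..2 * Suc n} (insert {2 * n + 1, 2 * n + 2} M)"
      unfolding eq using M(1) by (intro partition_on_insert[THEN iffD2]) (auto simp: disjnt_def partition_on_def)
    with M(2) show ?case
      by (intro exI[of _ "insert {2 * n + 1, 2 * n + 2} M"]) (auto simp: perfect_matchings_def)
  qed
  then obtain M where "M \<in> perfect_matchings {1..2 * n}" by blast
  hence "({1..2 * n}, replicate (D + 1) M) \<in> GEM D (2 * n)"
    by (auto simp: gems_def)
  thus ?thesis by blast
qed

end

theory Submission
  imports Defs
begin

text \<open>Write \<open>c\<close> for the number of components of a GEM. Pairs consisting of a GEM and a set of its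
  components correspond to pairs of GEMs on complementary label sets, so \<open>\<dd> D k m\<close> is the sum of
  \<open>(-1)\<^bsup>c + m - 1\<^esup> (c choose (m - 1))\<close> over all GEMs of size \<open>k\<close>, and the \<open>r\<close>-th partial sum of
  the expansion, multiplied by the number of GEMs, is the sum over all GEMs of size \<open>2 * n\<close> of these
  weights for all unions of components with at most \<open>2 * r\<close> labels. If there is a component with at
  least \<open>2 * n - 2 * r\<close> labels, then these unions are the arbitrary sets of other components, and
  inclusion-exclusion shows that the weights add up to \<open>1\<close> or \<open>0\<close> according to whether \<open>c = m\<close>.
  A GEM without such a component can be split into two closed parts with more than \<open>2 * r\<close> labels
  each, and there are few of these because the number of splittings into \<open>2 * j\<close> and \<open>2 * (n - j)\<close>
  labels decreases rapidly in \<open>j \<le> n / 2\<close>.\<close>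

subsection \<open>Perfect matchings\<close>

lemma perfect_matchings_empty: "perfect_matchings {} = {{}}"
  by (auto simp: perfect_matchings_def partition_on_def)

lemma perfect_matchingsD:
  assumes "M \<in> perfect_matchings U"
  shows "\<Union>M = U" "disjoint M" "\<And>e. e \<in> M \<Longrightarrow> card e = 2"
  using assms by (auto simp: perfect_matchings_def partition_on_def)

lemma perfect_matchingsI:
  assumes "\<Union>M = U" "disjoint M" "\<And>e. e \<in> M \<Longrightarrow> card e = 2"
  shows "M \<in> perfect_matchings U"
  using assms by (force simp: perfect_matchings_def partition_on_def)

lemma perfect_matchings_insert:
  assumes "M \<in> perfect_matchings (U - {x, y})" "x \<in> U" "y \<in> U" "x \<noteq> y"
  shows "insert {x, y} M \<in> perfect_matchings U" "{x, y} \<notin> M"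
proof -
  note M = perfect_matchingsD[OF assms(1)]
  have "disjnt {x, y} e" if "e \<in> M" for e
    using M(1) that by (auto simp: disjnt_def)
  then show "insert {x, y} M \<in> perfect_matchings U"
    using M assms by (intro perfect_matchingsI) (auto simp: pairwise_insert disjnt_sym)
  show "{x, y} \<notin> M" using M(1) by auto
qed

lemma perfect_matchings_remove:
  assumes "M \<in> perfect_matchings U" "e \<in> M"
  shows "M - {e} \<in> perfect_matchings (U - e)"
proof -
  note M = perfect_matchingsD[OF assms(1)]
  have "e \<inter> e' = {}" if "e' \<in> M - {e}" for e'
    using M(2) that assms(2) by (metis Diff_iff disjointD singletonI)
  then have "\<Union>(M - {e}) = U - e" using M(1) assms(2) by fastforce
  then show ?thesis
    using M by (intro perfect_matchingsI) (auto intro: pairwise_subset)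
qed

text \<open>The matchings are sorted by the partner \<open>y\<close> of the fixed label
  \<open>x\<close>; deleting the edge \<open>{x, y}\<close> leaves a matching of the other
  labels.\<close>

lemma perfect_matchings_rec:
  assumes "x \<in> U"
  shows "perfect_matchings U = (\<Union>y\<in>U - {x}. insert {x, y} ` perfect_matchings (U - {x, y}))"
    (is "_ = ?R")
proof (intro equalityI subsetI)
  fix M assume M: "M \<in> perfect_matchings U"
  note MD = perfect_matchingsD[OF M]
  obtain e where e: "e \<in> M" "x \<in> e" using MD(1) assms by auto
  obtain y where y: "e = {x, y}" "y \<noteq> x"
    using MD(3)[OF e(1)] e(2) by (auto simp: card_2_iff)
  have "y \<in> U" using e y MD(1) by auto
  moreover have "M - {e} \<in> perfect_matchings (U - {x, y})"
    using perfect_matchings_remove[OF M e(1)] y by simp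
  moreover have "M = insert {x, y} (M - {e})" using e y by auto
  ultimately show "M \<in> ?R" using y by blast
next
  fix M assume "M \<in> ?R"
  then show "M \<in> perfect_matchings U" using assms perfect_matchings_insert(1) by auto
qed

lemma finite_perfect_matchings:
  assumes "finite U"
  shows "finite (perfect_matchings U)"
proof -
  have "perfect_matchings U \<subseteq> Pow (Pow U)"
    by (auto simp: perfect_matchings_def partition_on_def)
  then show ?thesis using assms by (meson finite_Pow_iff finite_subset)
qed

lemma card_perfect_matchings_rec:
  assumes "finite U" "x \<in> U"
  shows "card (perfect_matchings U) = (\<Sum>y\<in>U - {x}. card (perfect_matchings (U - {x, y})))"
proof -
  have "card (perfect_matchings U)
      = (\<Sum>y\<in>U - {x}. card (insert {x, y} ` perfect_matchings (U - {x, y})))"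
    unfolding perfect_matchings_rec[OF assms(2)]
  proof (rule card_UN_disjoint)
    show "\<forall>y\<in>U - {x}. \<forall>z\<in>U - {x}. y \<noteq> z \<longrightarrow> insert {x, y} ` perfect_matchings (U - {x, y})
            \<inter> insert {x, z} ` perfect_matchings (U - {x, z}) = {}"
    proof (intro ballI impI)
      fix y z assume yz: "y \<in> U - {x}" "z \<in> U - {x}" "y \<noteq> z"
      have False if M: "M \<in> perfect_matchings (U - {x, y})" and M': "M' \<in> perfect_matchings (U - {x, z})"
        and eq: "insert {x, y} M = insert {x, z} M'" for M M'
      proof -
        have "{x, z} \<in> insert {x, y} M" using eq by auto
        then have "{x, z} \<in> M" using yz by (auto simp: doubleton_eq_iff)
        then show False using perfect_matchingsD(1)[OF M] by auto
      qed
      then show "insert {x, y} ` perfect_matchings (U - {x, y})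
            \<inter> insert {x, z} ` perfect_matchings (U - {x, z}) = {}" by blast
    qed
  qed (use assms in \<open>auto intro: finite_perfect_matchings\<close>)
  also have "\<dots> = (\<Sum>y\<in>U - {x}. card (perfect_matchings (U - {x, y})))"
  proof (rule sum.cong[OF refl], rule card_image)
    fix y assume y: "y \<in> U - {x}"
    show "inj_on (insert {x, y}) (perfect_matchings (U - {x, y}))"
      using perfect_matchings_insert(2)[of _ U x y] y assms
      by (intro inj_onI) (metis Diff_iff insertI1 insert_ident)
  qed
  finally show ?thesis .
qed

lemma card_perfect_matchings:
  assumes "finite U" "card U = 2 * n"
  shows "card (perfect_matchings U) = double_fact (2 * n - 1)"
  using assms
proof (induction n arbitrary: U)
  case 0
  then show ?case by (simp add: perfect_matchings_empty)
next
  case (Suc n)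
  then obtain x where x: "x \<in> U" by fastforce
  have "card (perfect_matchings (U - {x, y})) = double_fact (2 * n - 1)" if "y \<in> U - {x}" for y
    using Suc.prems x that by (intro Suc.IH) (auto simp: card_Diff_subset)
  then have "card (perfect_matchings U) = (2 * n + 1) * double_fact (2 * n - 1)"
    using Suc.prems x by (simp add: card_perfect_matchings_rec[OF _ x])
  \<comment> \<open>For \<open>n = 0\<close> truncated subtraction turns \<open>2 * n - 1\<close>
    into \<open>0\<close>, where \<open>double_fact\<close> has the value of \<open>(-1)!!\<close>;
    hence the case distinction.\<close>
  then show ?case by (cases n) auto
qed

lemma even_card_if_perfect_matching:
  assumes "finite U" "M \<in> perfect_matchings U"
  shows "even (card U)"
proof -
  note M = perfect_matchingsD[OF assms(2)]
  have "finite e" if "e \<in> M" for e using M(3)[OF that] card.infinite by fastforce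
  then have "card U = (\<Sum>e\<in>M. card e)"
    using M by (metis card_Union_disjoint)
  also have "\<dots> = (\<Sum>e\<in>M. 2)" using M by (intro sum.cong) auto
  finally show ?thesis by simp
qed

lemma gems_iff: "g \<in> gems D U \<longleftrightarrow>
    fst g = U \<and> length (snd g) = D + 1 \<and> set (snd g) \<subseteq> perfect_matchings U"
  by (cases g) (auto simp: gems_def)

lemma card_gems:
  assumes "finite U" "card U = 2 * n"
  shows "card (gems D U) = double_fact (2 * n - 1) ^ (D + 1)"
proof -
  have "card (gems D U) = card {\<alpha>. set \<alpha> \<subseteq> perfect_matchings U \<and> length \<alpha> = D + 1}"
    by (simp add: gems_def card_cartesian_product conj_commute)
  also have "\<dots> = card (perfect_matchings U) ^ (D + 1)"
    by (rule card_lists_length_eq[OF finite_perfect_matchings[OF assms(1)]])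
  finally show ?thesis by (simp only: card_perfect_matchings[OF assms])
qed

text \<open>The list of a GEM has \<open>D + 1 > 0\<close> entries, so without matchings there is no
  GEM, whatever \<open>D\<close> is.\<close>

lemma gems_odd:
  assumes "finite U" "odd (card U)"
  shows "gems D U = {}"
proof -
  have "perfect_matchings U = {}" using assms even_card_if_perfect_matching by blast
  then show ?thesis by (auto simp: gems_def)
qed

subsection \<open>Splitting along components\<close>

text \<open>The relation inside \<open>gem_components\<close>, named so that the general facts on
  quotients by an equivalence apply to it.\<close>

definition gem_conn :: "gem \<Rightarrow> (nat \<times> nat) set" where
  "gem_conn g = {(x, y). x \<in> fst g \<and> y \<in> fst g \<and> (x, y) \<in> (gem_adj g)\<^sup>*}"

lemma gem_components_conn: "gem_components g = fst g // gem_conn g"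
  by (simp add: gem_components_def gem_conn_def)

lemma sym_gem_adj: "sym (gem_adj g)"
  by (auto simp: gem_adj_def sym_def insert_commute)

lemma equiv_gem_conn: "equiv (fst g) (gem_conn g)"
proof (rule equivI)
  show "sym (gem_conn g)"
    using sym_rtrancl[OF sym_gem_adj] by (auto simp: gem_conn_def sym_def)
  show "trans (gem_conn g)"
    by (auto simp: gem_conn_def trans_def)
qed (auto simp: gem_conn_def refl_on_def)

lemma partition_gem_components: "partition_on (fst g) (gem_components g)"
  unfolding gem_components_conn by (rule partition_on_quotient[OF equiv_gem_conn])

lemma gem_adj_subset:
  assumes "g \<in> gems D U"
  shows "gem_adj g \<subseteq> U \<times> U"
proof -
  have "e \<subseteq> U" if "M \<in> set (snd g)" "e \<in> M" for M e
    using assms that perfect_matchingsD(1)[of M U] by (auto simp: gems_iff)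
  then show ?thesis by (force simp: gem_adj_def)
qed

text \<open>The two ends of an edge are adjacent, hence connected. It follows that no edge crosses
  the boundary of a union of components, which is what allows a GEM to be cut there.\<close>

lemma gem_edge_subset_component:
  assumes "g \<in> gems D U" "M \<in> set (snd g)" "e \<in> M" "C \<in> gem_components g" "e \<inter> C \<noteq> {}"
  shows "e \<subseteq> C"
proof
  fix y assume y: "y \<in> e"
  obtain x where x: "x \<in> e" "x \<in> C" using assms(5) by auto
  have M: "M \<in> perfect_matchings U" using assms by (auto simp: gems_iff)
  have "x = y \<or> e = {x, y}"
    using perfect_matchingsD(3)[OF M assms(3)] x y by (auto simp: card_2_iff)
  then have "x = y \<or> (x, y) \<in> gem_adj g" using assms by (auto simp: gem_adj_def)
  then have "(x, y) \<in> (gem_adj g)\<^sup>*" by auto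
  moreover have "x \<in> U" "y \<in> U" using x y assms(3) perfect_matchingsD(1)[OF M] by auto
  ultimately have "(x, y) \<in> gem_conn g" using assms(1) by (auto simp: gem_conn_def gems_iff)
  then show "y \<in> C"
    using in_quotient_imp_closed[OF equiv_gem_conn] assms(4) x
    unfolding gem_components_conn by blast
qed

section \<open>Disjoint unions and restrictions of GEMs\<close>

definition gem_join :: "gem \<Rightarrow> gem \<Rightarrow> gem" where
  "gem_join g h = (fst g \<union> fst h, map2 (\<union>) (snd g) (snd h))"

text \<open>Edges that leave \<open>W\<close> are dropped, so the result need not be a GEM; the
  hypothesis \<open>closed\<close> in the lemmas below excludes such edges.\<close>

definition gem_restrict :: "gem \<Rightarrow> nat set \<Rightarrow> gem" where
  "gem_restrict g W = (W, map (\<lambda>M. {e\<in>M. e \<subseteq> W}) (snd g))"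

lemma perfect_matchings_Un:
  assumes "M \<in> perfect_matchings U" "M' \<in> perfect_matchings V" "U \<inter> V = {}"
  shows "M \<union> M' \<in> perfect_matchings (U \<union> V)"
  using perfect_matchingsD[OF assms(1)] perfect_matchingsD[OF assms(2)] assms(3)
  by (intro perfect_matchingsI disjoint_union) auto

lemma gem_join_in_gems:
  assumes "g \<in> gems D U" "h \<in> gems D V" "U \<inter> V = {}"
  shows "gem_join g h \<in> gems D (U \<union> V)"
  using assms unfolding gems_iff gem_join_def
  by (auto intro!: perfect_matchings_Un dest: set_zip_leftD set_zip_rightD)

text \<open>\<open>map2\<close> stops at the end of the shorter list; equal lengths ensure that no
  colour is lost.\<close>

lemma gem_adj_join:
  assumes "length (snd g) = length (snd h)"
  shows "gem_adj (gem_join g h) = gem_adj g \<union> gem_adj h"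
proof -
  have "(\<exists>M\<in>set (map2 (\<union>) (snd g) (snd h)). e \<in> M) \<longleftrightarrow>
      (\<exists>M\<in>set (snd g). e \<in> M) \<or> (\<exists>M\<in>set (snd h). e \<in> M)" for e
    using assms by (induction rule: list_induct2) auto
  then show ?thesis by (auto simp: gem_adj_def gem_join_def)
qed

text \<open>A path that starts in \<open>A\<close> can only use steps of \<open>r\<close> and
  therefore stays in \<open>A\<close>; the induction carries \<open>y \<in> A\<close> along for this
  purpose.\<close>

lemma rtrancl_Un_disjoint:
  assumes "r \<subseteq> A \<times> A" "s \<subseteq> B \<times> B" "A \<inter> B = {}" "x \<in> A"
  shows "(x, y) \<in> (r \<union> s)\<^sup>* \<longleftrightarrow> (x, y) \<in> r\<^sup>*"
proof
  assume "(x, y) \<in> (r \<union> s)\<^sup>*"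
  then have "(x, y) \<in> r\<^sup>* \<and> y \<in> A"
  proof (induction rule: rtrancl_induct)
    case (step y z)
    then have "(y, z) \<in> r" using assms by auto
    then show ?case using step assms(1) by (auto intro: rtrancl_into_rtrancl)
  qed (use assms in auto)
  then show "(x, y) \<in> r\<^sup>*" ..
qed (meson in_rtrancl_UnI)

lemma gem_components_join:
  assumes g: "g \<in> gems D U" and h: "h \<in> gems D V" and disj: "U \<inter> V = {}"
  shows "gem_components (gem_join g h) = gem_components g \<union> gem_components h"
proof -
  note a = gem_adj_subset[OF g] and b = gem_adj_subset[OF h]
  have fst: "fst g = U" "fst h = V" using g h by (auto simp: gems_iff)
  have adj: "gem_adj (gem_join g h) = gem_adj g \<union> gem_adj h"
    using g h by (intro gem_adj_join) (auto simp: gems_iff)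
  have fst_join: "fst (gem_join g h) = U \<union> V" by (simp add: gem_join_def fst)
  have c: "(r\<^sup>* `` {x}) \<subseteq> A" if "r \<subseteq> A \<times> A" "x \<in> A" for r :: "(nat \<times> nat) set" and A x
    using that by (auto elim: rtranclE)
  have "gem_conn (gem_join g h) `` {x} = gem_conn g `` {x}" if "x \<in> U" for x
    using that rtrancl_Un_disjoint[OF a b disj that] c[OF a that] disj
    by (auto simp: gem_conn_def adj fst fst_join)
  moreover have "gem_conn (gem_join g h) `` {x} = gem_conn h `` {x}" if "x \<in> V" for x
    using that rtrancl_Un_disjoint[OF b a _ that] c[OF b that] disj
    by (auto simp: gem_conn_def adj fst fst_join Un_commute Int_commute)
  ultimately show ?thesis
    unfolding gem_components_conn quotient_def by (auto simp: fst fst_join)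
qed

lemma gem_restrict_in_gems:
  assumes g: "g \<in> gems D U" and W: "W \<subseteq> U"
    and closed: "\<And>M e. M \<in> set (snd g) \<Longrightarrow> e \<in> M \<Longrightarrow> e \<inter> W \<noteq> {} \<Longrightarrow> e \<subseteq> W"
  shows "gem_restrict g W \<in> gems D W"
proof -
  have "{e\<in>M. e \<subseteq> W} \<in> perfect_matchings W" if M: "M \<in> set (snd g)" for M
  proof (rule perfect_matchingsI)
    have MU: "M \<in> perfect_matchings U" using g M by (auto simp: gems_iff)
    show "\<Union>{e \<in> M. e \<subseteq> W} = W"
      using perfect_matchingsD(1)[OF MU] closed[OF M] W by blast
    show "disjoint {e \<in> M. e \<subseteq> W}"
      using perfect_matchingsD(2)[OF MU] by (auto intro: pairwise_subset)
    show "card e = 2" if "e \<in> {e \<in> M. e \<subseteq> W}" for e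
      using perfect_matchingsD(3)[OF MU] that by auto
  qed
  then show ?thesis using g by (auto simp: gems_iff gem_restrict_def)
qed

lemma gem_join_restrict:
  assumes g: "g \<in> gems D U" and W: "W \<subseteq> U"
    and closed: "\<And>M e. M \<in> set (snd g) \<Longrightarrow> e \<in> M \<Longrightarrow> e \<inter> W \<noteq> {} \<Longrightarrow> e \<subseteq> W"
  shows "gem_join (gem_restrict g W) (gem_restrict g (U - W)) = g"
proof -
  \<comment> \<open>An edge that meets \<open>W\<close> lies in \<open>W\<close>, and any other edge
    lies in the complement, so closedness of \<open>W\<close> alone suffices.\<close>
  have "{e\<in>M. e \<subseteq> W} \<union> {e\<in>M. e \<subseteq> U - W} = M" if M: "M \<in> set (snd g)" for M
  proof -
    have "M \<in> perfect_matchings U" using g M by (auto simp: gems_iff)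
    then show ?thesis using perfect_matchingsD(1)[of M U] closed[OF M] by blast
  qed
  then have "map2 (\<union>) (map (\<lambda>M. {e\<in>M. e \<subseteq> W}) (snd g)) (map (\<lambda>M. {e\<in>M. e \<subseteq> U - W}) (snd g)) = snd g"
    by (intro nth_equalityI) auto
  then show ?thesis
    using g W by (intro prod_eqI) (auto simp: gem_join_def gem_restrict_def gems_iff)
qed

lemma gem_restrict_join:
  assumes g: "g \<in> gems D U" and h: "h \<in> gems D V" and disj: "U \<inter> V = {}"
  shows "gem_restrict (gem_join g h) U = g" "gem_restrict (gem_join g h) V = h"
proof -
  have *: "{e \<in> M \<union> M'. e \<subseteq> U} = M" "{e \<in> M \<union> M'. e \<subseteq> V} = M'"
    if M: "M \<in> set (snd g)" and M': "M' \<in> set (snd h)" for M M'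
  proof -
    have "M \<in> perfect_matchings U" "M' \<in> perfect_matchings V"
      using g h M M' by (auto simp: gems_iff)
    note 1 = perfect_matchingsD[OF this(1)] and 2 = perfect_matchingsD[OF this(2)]
    \<comment> \<open>An edge has two elements, so it is not empty and cannot lie in both of the
      disjoint label sets.\<close>
    have "\<not> e \<subseteq> V" if "e \<in> M" for e
      using 1(1) 1(3)[OF that] that disj by (cases "e = {}") auto
    moreover have "\<not> e \<subseteq> U" if "e \<in> M'" for e
      using 2(1) 2(3)[OF that] that disj by (cases "e = {}") auto
    ultimately show "{e \<in> M \<union> M'. e \<subseteq> U} = M" "{e \<in> M \<union> M'. e \<subseteq> V} = M'"
      using 1(1) 2(1) by blast+
  qed
  have len: "length (snd g) = length (snd h)" "fst g = U" "fst h = V"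
    using g h by (auto simp: gems_iff)
  show "gem_restrict (gem_join g h) U = g"
    using len * by (intro prod_eqI nth_equalityI) (auto simp: gem_join_def gem_restrict_def)
  show "gem_restrict (gem_join g h) V = h"
    using len * by (intro prod_eqI nth_equalityI) (auto simp: gem_join_def gem_restrict_def)
qed

lemma gem_component_subset:
  assumes "g \<in> gems D U" "C \<in> gem_components g"
  shows "C \<subseteq> U"
  using partition_onD1[OF partition_gem_components[of g]] assms by (auto simp: gems_iff)

lemma Union_gem_components: "g \<in> gems D U \<Longrightarrow> \<Union>(gem_components g) = U"
  using partition_onD1[OF partition_gem_components[of g]] by (auto simp: gems_iff)

lemma gem_components_disjoint:
  assumes "g \<in> gems D U" "h \<in> gems D V" "U \<inter> V = {}"
  shows "gem_components g \<inter> gem_components h = {}"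
proof -
  have "C = {}" if "C \<in> gem_components g" "C \<in> gem_components h" for C
    using gem_component_subset[OF assms(1) that(1)] gem_component_subset[OF assms(2) that(2)] assms(3)
    by auto
  then show ?thesis using partition_onD3[OF partition_gem_components[of g]] by fastforce
qed

text \<open>No edge crosses the boundary of \<open>\<Union>S\<close>, so \<open>g\<close> is the
  join of its restrictions and its components are those of the two parts. Being nonempty and
  disjoint, each component is assigned to the part that contains it, and so the first part has
  exactly the components in \<open>S\<close>.\<close>

lemma gem_components_restrict:
  assumes g: "g \<in> gems D U" and S: "S \<subseteq> gem_components g"
  shows "gem_restrict g (\<Union>S) \<in> gems D (\<Union>S)"
    and "gem_restrict g (U - \<Union>S) \<in> gems D (U - \<Union>S)"
    and "gem_join (gem_restrict g (\<Union>S)) (gem_restrict g (U - \<Union>S)) = g"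
    and "gem_components (gem_restrict g (\<Union>S)) = S"
    and "gem_components (gem_restrict g (U - \<Union>S)) = gem_components g - S"
proof -
  have WU: "\<Union>S \<subseteq> U" using gem_component_subset[OF g] S by blast
  have cl: "e \<subseteq> \<Union>S" if "M \<in> set (snd g)" "e \<in> M" "e \<inter> \<Union>S \<noteq> {}" for M e
  proof -
    obtain C where "C \<in> S" "e \<inter> C \<noteq> {}" using \<open>e \<inter> \<Union>S \<noteq> {}\<close> by auto
    then show ?thesis using gem_edge_subset_component[OF g that(1,2), of C] S by blast
  qed
  have cl': "e \<subseteq> U - \<Union>S" if "M \<in> set (snd g)" "e \<in> M" "e \<inter> (U - \<Union>S) \<noteq> {}" for M e
  proof -
    have "M \<in> perfect_matchings U" using g that by (auto simp: gems_iff)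
    then have "e \<subseteq> U" using perfect_matchingsD(1)[of M U] that by auto
    then show ?thesis using cl[OF that(1,2)] that(3) by blast
  qed
  show 1: "gem_restrict g (\<Union>S) \<in> gems D (\<Union>S)" by (rule gem_restrict_in_gems[OF g WU cl])
  show 2: "gem_restrict g (U - \<Union>S) \<in> gems D (U - \<Union>S)"
    by (rule gem_restrict_in_gems[OF g _ cl']) auto
  show 3: "gem_join (gem_restrict g (\<Union>S)) (gem_restrict g (U - \<Union>S)) = g"
    by (rule gem_join_restrict[OF g WU cl])
  let ?A = "gem_components (gem_restrict g (\<Union>S))"
  let ?B = "gem_components (gem_restrict g (U - \<Union>S))"
  have eq: "gem_components g = ?A \<union> ?B"
    using gem_components_join[OF 1 2] 3 by auto
  have ne: "{} \<notin> gem_components g" by (rule partition_onD3[OF partition_gem_components])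
  have disj: "?A \<inter> ?B = {}" by (rule gem_components_disjoint[OF 1 2]) auto
  have "S \<subseteq> ?A"
  proof
    fix C assume C: "C \<in> S"
    have "C \<noteq> {}" "C \<subseteq> \<Union>S" using C ne S by auto
    then have "C \<notin> ?B" using gem_component_subset[OF 2, of C] by blast
    then show "C \<in> ?A" using eq C S by auto
  qed
  moreover have "C \<in> S" if C: "C \<in> ?A" for C
  proof -
    have "C \<noteq> {}" "C \<subseteq> \<Union>S" "C \<in> gem_components g"
      using ne C eq gem_component_subset[OF 1 C] by auto
    then obtain C' where C': "C' \<in> S" "C \<inter> C' \<noteq> {}" by blast
    then have "C = C'"
      using partition_onD2[OF partition_gem_components[of g]] \<open>C \<in> gem_components g\<close> S
      by (meson disjointD subsetD)
    then show ?thesis using C' by simp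
  qed
  ultimately show A: "?A = S" by blast
  show "?B = gem_components g - S" using eq disj A by blast
qed

lemma finite_gem_components:
  assumes "finite U" "g \<in> gems D U"
  shows "finite (gem_components g)"
proof (rule finite_subset)
  show "gem_components g \<subseteq> Pow U" using gem_component_subset[OF assms(2)] by auto
qed (use assms in simp)

text \<open>The double counting behind the whole proof. Cutting \<open>g\<close> along
  \<open>\<Union>S\<close> is a bijection from GEMs with a chosen set of components to pairs of GEMs
  on complementary label sets; the inverse joins the pair and recalls which components came from the
  first GEM.\<close>

lemma sum_gem_component_splits:
  fixes f :: "nat set set \<Rightarrow> nat set set \<Rightarrow> 'a :: comm_monoid_add"
  assumes U: "finite U"
  shows "(\<Sum>g\<in>gems D U. \<Sum>S\<in>Pow (gem_components g). f S (gem_components g - S)) =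
    (\<Sum>W\<in>Pow U. \<Sum>g'\<in>gems D W. \<Sum>g''\<in>gems D (U - W). f (gem_components g') (gem_components g''))"
proof -
  have fin: "finite W" if "W \<in> Pow U" for W using U that finite_subset by auto
  have "(\<Sum>g\<in>gems D U. \<Sum>S\<in>Pow (gem_components g). f S (gem_components g - S)) =
      (\<Sum>(g, S)\<in>Sigma (gems D U) (\<lambda>g. Pow (gem_components g)). f S (gem_components g - S))"
    using U by (intro sum.Sigma) (auto intro: finite_gems finite_gem_components)
  also have "\<dots> = (\<Sum>(W, g', g'')\<in>Sigma (Pow U) (\<lambda>W. gems D W \<times> gems D (U - W)).
      f (gem_components g') (gem_components g''))"
  proof (rule sum.reindex_bij_witness[where
        i = "\<lambda>(W, g', g''). (gem_join g' g'', gem_components g')" and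
        j = "\<lambda>(g, S). (\<Union>S, gem_restrict g (\<Union>S), gem_restrict g (U - \<Union>S))"], goal_cases)
    case (1 a)
    then obtain g S where a: "a = (g, S)" "g \<in> gems D U" "S \<subseteq> gem_components g" by auto
    then show ?case by (simp add: gem_components_restrict)
  next
    case (2 a)
    then obtain g S where a: "a = (g, S)" "g \<in> gems D U" "S \<subseteq> gem_components g" by auto
    then show ?case using gem_component_subset[OF a(2)] by (auto simp: gem_components_restrict)
  next
    case (3 b)
    then obtain W g' g'' where b: "b = (W, g', g'')" "W \<subseteq> U" "g' \<in> gems D W" "g'' \<in> gems D (U - W)"
      by auto
    then show ?case
      by (simp add: Union_gem_components[OF b(3)] gem_restrict_join[OF b(3,4)])
  next
    case (4 b)
    then obtain W g' g'' where b: "b = (W, g', g'')" "W \<subseteq> U" "g' \<in> gems D W" "g'' \<in> gems D (U - W)"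
      by auto
    then have "W \<union> (U - W) = U" by auto
    then show ?case
      using gem_join_in_gems[OF b(3,4)] gem_components_join[OF b(3,4)] b(1) by auto
  next
    case (5 a)
    then obtain g S where a: "a = (g, S)" "g \<in> gems D U" "S \<subseteq> gem_components g" by auto
    then show ?case by (simp add: gem_components_restrict)
  qed
  also have "\<dots> = (\<Sum>W\<in>Pow U. \<Sum>(g', g'')\<in>gems D W \<times> gems D (U - W).
      f (gem_components g') (gem_components g''))"
    using U fin by (intro sum.Sigma[symmetric]) (auto intro!: finite_gems)
  also have "\<dots> = (\<Sum>W\<in>Pow U. \<Sum>g'\<in>gems D W. \<Sum>g''\<in>gems D (U - W).
      f (gem_components g') (gem_components g''))"
    by (simp only: sum.cartesian_product)
  finally show ?thesis .
qed

subsection \<open>Relabelling\<close>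

definition gem_image :: "(nat \<Rightarrow> nat) \<Rightarrow> gem \<Rightarrow> gem" where
  "gem_image f g = (f ` fst g, map ((`) ((`) f)) (snd g))"

lemma perfect_matchings_image:
  assumes "M \<in> perfect_matchings U" "inj_on f U"
  shows "(`) f ` M \<in> perfect_matchings (f ` U)"
proof (rule perfect_matchingsI)
  note M = perfect_matchingsD[OF assms(1)]
  show "\<Union> ((`) f ` M) = f ` U" using M(1) by auto
  show "disjoint ((`) f ` M)" using M(1,2) assms(2) by (intro disjoint_image) auto
  fix e assume "e \<in> (`) f ` M"
  then obtain e' where e: "e = f ` e'" "e' \<in> M" by auto
  have "inj_on f e'" using assms(2) e(2) M(1) by (auto intro: inj_on_subset)
  then show "card e = 2" using M(3)[OF e(2)] e(1) by (simp add: card_image)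
qed

lemma gem_image_in_gems:
  assumes "g \<in> gems D U" "inj_on f U"
  shows "gem_image f g \<in> gems D (f ` U)"
  using assms by (auto simp: gems_iff gem_image_def intro!: perfect_matchings_image)

lemma gem_image_inverse:
  assumes g: "g \<in> gems D U" and inv: "\<And>x. x \<in> U \<Longrightarrow> f' (f x) = x"
  shows "gem_image f' (gem_image f g) = g"
proof -
  have *: "f' ` f ` W = W" if "W \<subseteq> U" for W
    using that inv by (force simp: image_image)
  have "(`) f' ` (`) f ` M = M" if "M \<in> set (snd g)" for M
  proof -
    have "M \<in> perfect_matchings U" using g that by (auto simp: gems_iff)
    then have "e \<subseteq> U" if "e \<in> M" for e using perfect_matchingsD(1)[of M U] that by auto
    then show ?thesis using * by (force simp: image_image)
  qed
  then show ?thesis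
    using g *[of U] by (intro prod_eqI) (auto simp: gem_image_def gems_iff intro: map_idI)
qed

text \<open>Paths are mapped to paths by an arbitrary \<open>f\<close>. Injectivity enters only
  afterwards, when this is applied to an inverse of \<open>f\<close> as well.\<close>

lemma gem_conn_image_mono:
  assumes "(x, y) \<in> gem_conn g"
  shows "(f x, f y) \<in> gem_conn (gem_image f g)"
proof -
  have adj: "(f a, f b) \<in> gem_adj (gem_image f g)" if ab: "(a, b) \<in> gem_adj g" for a b
  proof -
    obtain M where M: "M \<in> set (snd g)" "{a, b} \<in> M" using ab by (auto simp: gem_adj_def)
    then have "f ` {a, b} \<in> (`) f ` M" by (intro imageI)
    then show ?thesis using M(1) by (auto simp: gem_adj_def gem_image_def)
  qed
  have "(f x, f y) \<in> (gem_adj (gem_image f g))\<^sup>*" if "(x, y) \<in> (gem_adj g)\<^sup>*"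
    using that
  proof (induction rule: rtrancl_induct)
    case (step y z)
    then show ?case using adj[OF step.hyps(2)] by (blast intro: rtrancl_into_rtrancl)
  qed simp
  then show ?thesis using assms by (auto simp: gem_conn_def gem_image_def)
qed

lemma pi0_gem_image:
  assumes g: "g \<in> gems D U" and f: "inj_on f U"
  shows "\<pi>\<^sub>0 (gem_image f g) = \<pi>\<^sub>0 g"
proof -
  have U: "fst g = U" using g by (simp add: gems_iff)
  have conn: "(f x, f y) \<in> gem_conn (gem_image f g) \<longleftrightarrow> (x, y) \<in> gem_conn g"
    if "x \<in> U" "y \<in> U" for x y
  proof
    have inv: "inv_into U f (f x) = x" if "x \<in> U" for x using f that by simp
    assume "(f x, f y) \<in> gem_conn (gem_image f g)"
    then show "(x, y) \<in> gem_conn g"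
      using gem_conn_image_mono[of "f x" "f y" "gem_image f g" "inv_into U f"] inv that
      by (simp add: gem_image_inverse[where f = f and f' = "inv_into U f", OF g inv])
  qed (rule gem_conn_image_mono)
  have sub: "gem_conn h \<subseteq> fst h \<times> fst h" for h by (auto simp: gem_conn_def)
  have fst: "fst (gem_image f g) = f ` U" by (simp add: gem_image_def U)
  have cls: "gem_conn (gem_image f g) `` {f x} = f ` (gem_conn g `` {x})" if "x \<in> U" for x
  proof (intro equalityI subsetI)
    fix z assume z: "z \<in> gem_conn (gem_image f g) `` {f x}"
    then obtain y where y: "y \<in> U" "z = f y" using sub[of "gem_image f g"] fst by auto
    then show "z \<in> f ` (gem_conn g `` {x})" using conn[OF that y(1)] z by auto
  next
    fix z assume "z \<in> f ` (gem_conn g `` {x})"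
    then show "z \<in> gem_conn (gem_image f g) `` {f x}" by (auto intro: gem_conn_image_mono)
  qed
  have "gem_components (gem_image f g) = (`) f ` gem_components g"
    unfolding gem_components_conn quotient_def fst U using cls by auto
  moreover have "inj_on ((`) f) (gem_components g)"
    using inj_on_image_Pow[OF f] gem_component_subset[OF g] by (auto intro: inj_on_subset)
  ultimately show ?thesis by (simp add: \<pi>\<^sub>0_def card_image)
qed

text \<open>A bijection of label sets induces a bijection of GEMs that preserves
  \<open>\<pi>\<^sub>0\<close>. This allows any label set to be replaced by
  \<open>{1..N}\<close>.\<close>

lemma sum_gems_cong_card:
  assumes "finite U" "finite V" "card U = card V"
  shows "(\<Sum>g\<in>gems D U. \<phi> (\<pi>\<^sub>0 g)) = (\<Sum>g\<in>gems D V. \<phi> (\<pi>\<^sub>0 g))"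
proof -
  obtain f where f: "bij_betw f U V" using assms finite_same_card_bij by blast
  define f' where "f' = inv_into U f"
  have f': "bij_betw f' V U" unfolding f'_def by (rule bij_betw_inv_into[OF f])
  have inv: "x \<in> U \<Longrightarrow> f' (f x) = x" "y \<in> V \<Longrightarrow> f (f' y) = y" for x y
    using f by (auto simp: f'_def bij_betw_inv_into_left bij_betw_inv_into_right)
  show ?thesis
  proof (rule sum.reindex_bij_witness[where i = "gem_image f'" and j = "gem_image f"], goal_cases)
    case (1 g) then show ?case by (intro gem_image_inverse[where f = f and f' = f' and U = U and D = D] inv(1))
  next
    case (2 g) then show ?case
      using gem_image_in_gems[of g D U f] f by (simp add: bij_betw_def)
  next
    case (3 g) then show ?case by (intro gem_image_inverse[where f = f' and f' = f and U = V and D = D] inv(2))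
  next
    case (4 g) then show ?case
      using gem_image_in_gems[of g D V f'] f' by (simp add: bij_betw_def)
  next
    case (5 g) then show ?case using pi0_gem_image[of g D U f] f by (simp add: bij_betw_def)
  qed
qed

lemma card_gems_cong_card:
  assumes "finite U" "finite V" "card U = card V"
  shows "card (gems D U) = card (gems D V)"
  using sum_gems_cong_card[OF assms, of "\<lambda>_. 1::nat" D] by simp

subsection \<open>The coefficients as weighted counts\<close>

lemma sum_Pow_card:
  fixes \<phi> :: "nat \<Rightarrow> 'a :: semiring_1"
  assumes "finite U"
  shows "(\<Sum>W\<in>Pow U. \<phi> (card W)) = (\<Sum>i\<le>card U. of_nat (card U choose i) * \<phi> i)"
proof -
  have "(\<Sum>W\<in>Pow U. \<phi> (card W)) = (\<Sum>i\<le>card U. \<Sum>W\<in>{W\<in>Pow U. card W = i}. \<phi> (card W))"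
    using assms by (intro sum.group[symmetric]) (auto intro: card_mono)
  also have "\<dots> = (\<Sum>i\<le>card U. of_nat (card U choose i) * \<phi> i)"
    using n_subsets[OF assms] by (intro sum.cong) auto
  finally show ?thesis .
qed

text \<open>This evaluates the right-hand side of \<open>sum_gem_component_splits\<close> for
  weights that ignore \<open>g''\<close>: the latter contributes only a count, and the sets
  \<open>W\<close> of size \<open>i\<close> contribute equally, which yields the binomial
  coefficient.\<close>

lemma sum_gem_pairs_card:
  fixes F :: "nat \<Rightarrow> 'a :: semiring_1"
  assumes "finite U"
  shows "(\<Sum>W\<in>Pow U. \<Sum>g'\<in>gems D W. \<Sum>g''\<in>gems D (U - W). F (card W) * \<phi> (\<pi>\<^sub>0 g'))
    = (\<Sum>i\<le>card U. of_nat (card U choose i) *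
        (F i * (\<Sum>g\<in>GEM D i. \<phi> (\<pi>\<^sub>0 g)) * of_nat (card (GEM D (card U - i)))))"
proof -
  have "(\<Sum>g'\<in>gems D W. \<Sum>g''\<in>gems D (U - W). F (card W) * \<phi> (\<pi>\<^sub>0 g')) =
      F (card W) * (\<Sum>g\<in>GEM D (card W). \<phi> (\<pi>\<^sub>0 g)) * of_nat (card (GEM D (card U - card W)))"
    if "W \<in> Pow U" for W
  proof -
    have fin: "finite W" "finite (U - W)" using that assms finite_subset by auto
    have "(\<Sum>g'\<in>gems D W. \<Sum>g''\<in>gems D (U - W). F (card W) * \<phi> (\<pi>\<^sub>0 g')) =
        F (card W) * (\<Sum>g'\<in>gems D W. \<phi> (\<pi>\<^sub>0 g')) * of_nat (card (gems D (U - W)))"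
      by (simp add: sum_distrib_left sum_distrib_right of_nat_mult mult_of_nat_commute)
    also have "card (gems D (U - W)) = card (GEM D (card U - card W))"
      using that fin by (intro card_gems_cong_card) (auto simp: card_Diff_subset)
    also have "(\<Sum>g'\<in>gems D W. \<phi> (\<pi>\<^sub>0 g')) = (\<Sum>g\<in>GEM D (card W). \<phi> (\<pi>\<^sub>0 g))"
      using fin by (intro sum_gems_cong_card) auto
    finally show ?thesis .
  qed
  then show ?thesis
    using sum_Pow_card[OF assms, of "\<lambda>i. F i * (\<Sum>g\<in>GEM D i. \<phi> (\<pi>\<^sub>0 g)) * of_nat (card (GEM D (card U - i)))"]
    by simp
qed

text \<open>Sums over sizes of GEMs have no odd terms; this converts them, after truncation at
  \<open>2 * r\<close>, into sums over the index \<open>k\<close> of the expansion.\<close>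

lemma sum_even_indices:
  fixes h :: "nat \<Rightarrow> 'a :: comm_monoid_add"
  assumes "r \<le> n" "\<And>i. odd i \<Longrightarrow> h i = 0" "\<And>i. i > 2 * r \<Longrightarrow> h i = 0"
  shows "(\<Sum>i\<le>2 * n. h i) = (\<Sum>k\<le>r. h (2 * k))"
proof -
  have "(\<Sum>k\<le>r. h (2 * k)) = sum h ((*) 2 ` {..r})"
    by (subst sum.reindex) (auto simp: inj_on_def)
  also have "\<dots> = (\<Sum>i\<le>2 * n. h i)"
  proof (rule sum.mono_neutral_left)
    show "\<forall>i\<in>{..2 * n} - (*) 2 ` {..r}. h i = 0"
    proof
      fix i assume i: "i \<in> {..2 * n} - (*) 2 ` {..r}"
      show "h i = 0"
      proof (cases "odd i")
        case False
        then obtain k where "i = 2 * k" by (auto elim: evenE)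
        then show ?thesis using i by (intro assms(3)) auto
      qed (rule assms(2))
    qed
  qed (use assms(1) in auto)
  finally show ?thesis by simp
qed

text \<open>The number of ways to choose \<open>p\<close> of \<open>c\<close> components, with the
  sign given by the parity of the other \<open>c - p\<close>. The exponent \<open>c + p\<close> has
  the same parity and avoids truncated subtraction.\<close>

definition signed_choose :: "nat \<Rightarrow> nat \<Rightarrow> int" where
  "signed_choose p c = (-1) ^ (c + p) * int (c choose p)"

lemma sum_Pow_card_eq:
  fixes c :: "'b :: semiring_1"
  assumes "finite T"
  shows "(\<Sum>S\<in>Pow T. if card S = p then c else 0) = of_nat (card T choose p) * c"
proof -
  have "(\<Sum>S\<in>Pow T. if card S = p then c else 0) = (\<Sum>S\<in>{S\<in>Pow T. card S = p}. c)"
    using assms by (intro sum.inter_filter[symmetric]) auto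
  then show ?thesis using n_subsets[OF assms, of p] by simp
qed

text \<open>Moebius inversion on the subset lattice: up to sign conventions,
  \<open>signed_choose p\<close> is the transform of the indicator of the sets of size
  \<open>p\<close>, and summing over subsets inverts the transform.\<close>

lemma sum_signed_choose:
  assumes "finite T"
  shows "(\<Sum>S\<in>Pow T. signed_choose p (card S)) = (if card T = p then 1 else 0)"
proof -
  have "(if card T = p then 1 else 0) =
      (\<Sum>S\<in>Pow T. (-1) ^ card S * ((-1) ^ p * int (card S choose p)))"
  proof (rule inclusion_exclusion_symmetric[OF _ assms])
    fix S :: "'a set" assume S: "finite S"
    have "(\<Sum>T\<in>Pow S. (-1) ^ card T * (if card T = p then 1 else 0)) =
        (\<Sum>T\<in>Pow S. if card T = p then (-1) ^ p else (0::int))"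
      by (intro sum.cong) auto
    then show "(-1) ^ p * int (card S choose p) =
        (\<Sum>T\<in>Pow S. (-1) ^ card T * (if card T = p then 1 else 0))"
      by (simp only: sum_Pow_card_eq[OF S] mult.commute)
  qed
  then show ?thesis by (simp add: signed_choose_def power_add mult.assoc)
qed

text \<open>The label set \<open>W\<close> of \<open>g'\<close> determines both
  \<open>i = card W\<close> and the label set of \<open>g''\<close>. Since \<open>W\<close> can be
  recovered from \<open>g'\<close>, forgetting it in a triple \<open>(W, g', g'')\<close> is
  injective.\<close>

lemma card_gem_product:
  "int (card {(g', g''). \<exists>i\<le>k. (g', g'') \<in> gem_product D i (k - i) \<and> Q g' g''}) =
    (\<Sum>W\<in>Pow {1..k}. \<Sum>g'\<in>gems D W. \<Sum>g''\<in>gems D ({1..k} - W). if Q g' g'' then 1 else 0)"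
proof -
  let ?P = "Sigma (Pow {1..k}) (\<lambda>W. gems D W \<times> gems D ({1..k} - W))"
  have fin: "finite W" if "W \<in> Pow {1..k}" for W
    using that finite_subset by auto
  have finP: "finite ?P"
    by (intro finite_SigmaI finite_cartesian_product finite_gems) (use fin in auto)
  have eq: "{(g', g''). \<exists>i\<le>k. (g', g'') \<in> gem_product D i (k - i) \<and> Q g' g''} =
      snd ` {x\<in>?P. Q (fst (snd x)) (snd (snd x))}" (is "?L = ?R")
  proof (intro equalityI subsetI)
    fix x assume "x \<in> ?L"
    then obtain g' g'' i U' U'' where x: "x = (g', g'')" "i \<le> k" "Q g' g''"
      "U' \<union> U'' = {1..i + (k - i)}" "U' \<inter> U'' = {}" "g' \<in> gems D U'" "g'' \<in> gems D U''"
      by (auto simp: gem_product_def)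
    then have "U' \<in> Pow {1..k}" "U'' = {1..k} - U'" by auto
    then have "(U', g', g'') \<in> {x\<in>?P. Q (fst (snd x)) (snd (snd x))}" using x by auto
    then show "x \<in> ?R" by (rule image_eqI[rotated]) (simp add: x(1))
  next
    fix x assume "x \<in> ?R"
    then obtain W g' g'' where x: "x = (g', g'')" "W \<subseteq> {1..k}" "Q g' g''"
      "g' \<in> gems D W" "g'' \<in> gems D ({1..k} - W)"
      by auto
    have "card W \<le> k" using card_mono[OF _ x(2)] by simp
    moreover have "card ({1..k} - W) = k - card W"
      using x(2) fin[of W] by (simp add: card_Diff_subset)
    moreover have "W \<union> ({1..k} - W) = {1..k}" using x(2) by auto
    ultimately have "(g', g'') \<in> gem_product D (card W) (k - card W)"
      unfolding gem_product_def mem_Collect_eq case_prod_conv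
      using x by (intro exI[of _ W] exI[of _ "{1..k} - W"]) auto
    then show "x \<in> ?L" using x \<open>card W \<le> k\<close> by auto
  qed
  have "inj_on snd ?P"
    by (auto simp: inj_on_def gems_iff)
  then have "card (snd ` {x\<in>?P. Q (fst (snd x)) (snd (snd x))}) =
      card {x\<in>?P. Q (fst (snd x)) (snd (snd x))}"
    by (intro card_image) (auto intro: inj_on_subset)
  then have "int (card ?L) = (\<Sum>x\<in>{x\<in>?P. Q (fst (snd x)) (snd (snd x))}. 1)"
    by (simp only: eq) simp
  also have "\<dots> = (\<Sum>x\<in>?P. if Q (fst (snd x)) (snd (snd x)) then 1 else 0)"
    by (rule sum.inter_filter[OF finP])
  also have "\<dots> = (\<Sum>W\<in>Pow {1..k}. \<Sum>(g', g'')\<in>gems D W \<times> gems D ({1..k} - W).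
      if Q g' g'' then 1 else 0)"
    using fin by (subst sum.Sigma) (auto intro!: finite_gems simp: case_prod_unfold)
  finally show ?thesis by (simp only: sum.cartesian_product)
qed

text \<open>A pair amounts to a GEM with a selected set of \<open>m - 1\<close> components, those of
  \<open>g'\<close>. The sign depends on the number of unselected components only, which is the same
  for all selections in a given GEM.\<close>

lemma dd_eq_sum_signed_choose:
  "\<dd> D k m = (\<Sum>g\<in>GEM D k. signed_choose (m - 1) (\<pi>\<^sub>0 g))"
proof -
  have "\<dd> D k m = (\<Sum>W\<in>Pow {1..k}. \<Sum>g'\<in>gems D W. \<Sum>g''\<in>gems D ({1..k} - W).
      (if \<pi>\<^sub>0 g' = m - 1 \<and> even (\<pi>\<^sub>0 g'') then 1 else 0) -
      (if \<pi>\<^sub>0 g' = m - 1 \<and> odd (\<pi>\<^sub>0 g'') then 1 else 0))"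
    unfolding \<dd>_def card_gem_product by (simp only: sum_subtractf)
  also have "\<dots> = (\<Sum>W\<in>Pow {1..k}. \<Sum>g'\<in>gems D W. \<Sum>g''\<in>gems D ({1..k} - W).
      if card (gem_components g') = m - 1 then (-1) ^ card (gem_components g'') else 0)"
    by (intro sum.cong refl) (auto simp: \<pi>\<^sub>0_def)
  also have "\<dots> = (\<Sum>g\<in>GEM D k. \<Sum>S\<in>Pow (gem_components g).
      if card S = m - 1 then (-1) ^ card (gem_components g - S) else 0)"
    by (rule sum_gem_component_splits[symmetric]) simp
  also have "\<dots> = (\<Sum>g\<in>GEM D k. signed_choose (m - 1) (\<pi>\<^sub>0 g))"
  proof (rule sum.cong[OF refl])
    fix g assume g: "g \<in> GEM D k"
    have fin: "finite (gem_components g)" by (rule finite_gem_components[OF _ g]) simp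
    have "(-1) ^ card (gem_components g - S) = ((-1) ^ (\<pi>\<^sub>0 g + (m - 1)) :: int)"
      if "S \<subseteq> gem_components g" "card S = m - 1" for S
    proof -
      have "card (gem_components g - S) + card S = \<pi>\<^sub>0 g"
        unfolding \<pi>\<^sub>0_def using that fin finite_subset[OF that(1) fin] card_mono[OF fin that(1)]
        by (simp add: card_Diff_subset)
      \<comment> \<open>Adding \<open>m - 1\<close> instead of subtracting it changes the exponent
        by an even number.\<close>
      then have "\<pi>\<^sub>0 g + (m - 1) = card (gem_components g - S) + 2 * (m - 1)" using that by simp
      then show ?thesis by (simp only: power_add power_mult) simp
    qed
    then have "(\<Sum>S\<in>Pow (gem_components g).
        if card S = m - 1 then (-1) ^ card (gem_components g - S) else 0) =
        (\<Sum>S\<in>Pow (gem_components g). if card S = m - 1 then (-1) ^ (\<pi>\<^sub>0 g + (m - 1)) else (0::int))"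
      by (intro sum.cong) auto
    also have "\<dots> = signed_choose (m - 1) (\<pi>\<^sub>0 g)"
      unfolding sum_Pow_card_eq[OF fin] signed_choose_def \<pi>\<^sub>0_def by simp
    finally show "(\<Sum>S\<in>Pow (gem_components g).
        if card S = m - 1 then (-1) ^ card (gem_components g - S) else 0) =
        signed_choose (m - 1) (\<pi>\<^sub>0 g)" .
  qed
  finally show ?thesis .
qed

subsection \<open>The truncated expansion\<close>

lemma gem_component_finite:
  assumes "finite U" "g \<in> gems D U" "C \<in> gem_components g"
  shows "finite C" "C \<noteq> {}"
  using finite_subset[OF gem_component_subset[OF assms(2,3)] assms(1)]
    partition_onD3[OF partition_gem_components[of g]] assms(3) by auto

text \<open>Components are disjoint and nonempty. Thus a union with at most \<open>R\<close> labels
  involves at most \<open>R\<close> components, which later bounds its weight independently of the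
  size of the GEM.\<close>

lemma card_le_card_Union_gem_components:
  assumes "finite U" "g \<in> gems D U" "S \<subseteq> gem_components g"
  shows "card S \<le> card (\<Union>S)"
proof -
  have fin: "finite C" "C \<noteq> {}" if "C \<in> S" for C
    using gem_component_finite[OF assms(1,2)] assms(3) that by auto
  have "disjoint S"
    using partition_onD2[OF partition_gem_components[of g]] assms(3) by (rule pairwise_subset)
  then have "card (\<Union>S) = (\<Sum>C\<in>S. card C)"
    using fin by (intro card_Union_disjoint) auto
  also have "\<dots> \<ge> (\<Sum>C\<in>S. 1)"
    using fin by (intro sum_mono) (simp add: Suc_le_eq card_gt_0_iff)
  finally show ?thesis by simp
qed

text \<open>Adding the sets one at a time, the cardinality of the union cannot jump over the interval
  from \<open>R + 1\<close> to \<open>2 * R\<close>.\<close>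

lemma exists_subfamily_Union_card:
  assumes "finite \<C>" "\<And>C. C \<in> \<C> \<Longrightarrow> card C \<le> R" "R < card (\<Union>\<C>)"
  shows "\<exists>S\<subseteq>\<C>. R < card (\<Union>S) \<and> card (\<Union>S) \<le> 2 * R"
  using assms
proof (induction rule: finite_induct)
  case (insert C \<C>)
  show ?case
  proof (cases "R < card (\<Union>\<C>)")
    case True
    then show ?thesis using insert by (meson insertI2 order_trans subset_insertI)
  next
    case False
    have "card (\<Union>(insert C \<C>)) \<le> card C + card (\<Union>\<C>)"
      by (simp add: card_Un_le)
    also have "\<dots> \<le> 2 * R" using False insert.prems(1)[of C] by simp
    finally show ?thesis using insert.prems(2) by blast
  qed
qed simp

section \<open>GEMs without a component that covers all but at most \<open>R\<close> labels\<close>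

definition small_gems :: "nat \<Rightarrow> nat set \<Rightarrow> nat \<Rightarrow> gem set" where
  "small_gems D U R = {g \<in> gems D U. \<forall>C\<in>gem_components g. card C + R < card U}"

text \<open>The number of GEMs of size \<open>N\<close> with a chosen union of components that has
  more than \<open>R\<close> labels inside and more than \<open>R\<close> outside.\<close>

definition split_count :: "nat \<Rightarrow> nat \<Rightarrow> nat \<Rightarrow> nat" where
  "split_count D N R =
     (\<Sum>i | R < i \<and> i + R < N. (N choose i) * (card (GEM D i) * card (GEM D (N - i))))"

text \<open>A component with more than \<open>R\<close> labels works by itself, since smallness
  leaves more than \<open>R\<close> labels outside. If there is none, some union of components has
  between \<open>R + 1\<close> and \<open>2 * R\<close> labels, and \<open>3 * R < card U\<close>
  leaves more than \<open>R\<close> for the rest.\<close>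

lemma small_gem_splits:
  assumes U: "finite U" "3 * R < card U" and g: "g \<in> small_gems D U R"
  shows "\<exists>S\<subseteq>gem_components g. R < card (\<Union>S) \<and> card (\<Union>S) + R < card U"
proof (cases "\<exists>C\<in>gem_components g. R < card C")
  case True
  then obtain C where C: "C \<in> gem_components g" "R < card C" by blast
  then show ?thesis using g by (intro exI[of _ "{C}"]) (auto simp: small_gems_def)
next
  case False
  have g': "g \<in> gems D U" using g by (simp add: small_gems_def)
  obtain S where "S \<subseteq> gem_components g" "R < card (\<Union>S)" "card (\<Union>S) \<le> 2 * R"
    using False U finite_gem_components[OF U(1) g']
      exists_subfamily_Union_card[of "gem_components g" R]
    by (auto simp: Union_gem_components[OF g'] not_less)
  then show ?thesis using U(2) by (intro exI[of _ S]) auto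
qed

text \<open>Each small GEM admits at least one balanced splitting, detected by the indicator
  \<open>F\<close>, and \<open>split_count\<close> counts all such splittings.\<close>

lemma card_small_gems_le:
  assumes U: "finite U" "3 * R < card U"
  shows "card (small_gems D U R) \<le> split_count D (card U) R"
proof -
  define F :: "nat \<Rightarrow> nat" where "F i = (if R < i \<and> i + R < card U then 1 else 0)" for i
  have small: "small_gems D U R \<subseteq> gems D U" by (auto simp: small_gems_def)
  have fin: "finite (Pow (gem_components g))" if "g \<in> gems D U" for g
    using finite_gem_components[OF U(1) that] by simp
  have ge1: "1 \<le> (\<Sum>S\<in>Pow (gem_components g). F (card (\<Union>S)))" if g: "g \<in> small_gems D U R" for g
  proof -
    obtain S where S: "S \<in> Pow (gem_components g)" "F (card (\<Union>S)) = 1"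
      using small_gem_splits[OF U g] by (auto simp: F_def)
    then show ?thesis
      using member_le_sum[OF S(1) _ fin, of "\<lambda>S. F (card (\<Union>S))"] small g by auto
  qed
  have "card (small_gems D U R) = (\<Sum>g\<in>small_gems D U R. 1)" by simp
  also have "\<dots> \<le> (\<Sum>g\<in>small_gems D U R. \<Sum>S\<in>Pow (gem_components g). F (card (\<Union>S)))"
    by (intro sum_mono ge1)
  also have "\<dots> \<le> (\<Sum>g\<in>gems D U. \<Sum>S\<in>Pow (gem_components g). F (card (\<Union>S)))"
    using small finite_gems[OF U(1)] by (intro sum_mono2) auto
  also have "\<dots> = (\<Sum>W\<in>Pow U. \<Sum>g'\<in>gems D W. \<Sum>g''\<in>gems D (U - W). F (card (\<Union>(gem_components g'))))"
    by (rule sum_gem_component_splits[OF U(1)])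
  also have "\<dots> = (\<Sum>W\<in>Pow U. \<Sum>g'\<in>gems D W. \<Sum>g''\<in>gems D (U - W). F (card W) * 1)"
    by (intro sum.cong refl) (auto simp: Union_gem_components)
  also have "\<dots> = (\<Sum>i\<le>card U. (card U choose i) * (F i * card (GEM D i) * card (GEM D (card U - i))))"
    by (subst sum_gem_pairs_card[OF U(1)]) simp
  also have "\<dots> = split_count D (card U) R"
    unfolding split_count_def by (intro sum.mono_neutral_cong_right) (auto simp: F_def)
  finally show ?thesis .
qed

text \<open>For \<open>R = 2 * r\<close> and \<open>p = m - 1\<close> this is the contribution of
  the single GEM \<open>g\<close> to the \<open>r\<close>-th partial sum of the expansion.\<close>

definition truncated_sum :: "nat \<Rightarrow> nat \<Rightarrow> gem \<Rightarrow> int" where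
  "truncated_sum R p g = (\<Sum>S\<in>Pow (gem_components g).
     if card (\<Union>S) \<le> R then signed_choose p (card S) else 0)"

text \<open>A component with at least \<open>card U - R\<close> elements is never used by a union of at most
  \<open>R\<close> elements, and all the others can be used freely.\<close>

lemma truncated_sum_not_small:
  assumes U: "finite U" "2 * R < card U" and g: "g \<in> gems D U - small_gems D U R"
  shows "truncated_sum R p g = (if \<pi>\<^sub>0 g = Suc p then 1 else 0)"
proof -
  have g': "g \<in> gems D U" using g by simp
  note fin = finite_gem_components[OF U(1) g']
  obtain C where C: "C \<in> gem_components g" "card U \<le> card C + R"
    using g by (auto simp: small_gems_def not_less)
  have CU: "C \<subseteq> U" by (rule gem_component_subset[OF g' C(1)])
  have iff: "card (\<Union>S) \<le> R \<longleftrightarrow> S \<subseteq> gem_components g - {C}" if S: "S \<subseteq> gem_components g" for S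
  proof
    assume le: "card (\<Union>S) \<le> R"
    have "\<Union>S \<subseteq> U" using gem_component_subset[OF g'] S by blast
    then have "finite (\<Union>S)" using U(1) by (rule finite_subset)
    have "C \<notin> S"
    proof
      assume "C \<in> S"
      then have "card C \<le> card (\<Union>S)" using \<open>finite (\<Union>S)\<close> by (intro card_mono) auto
      \<comment> \<open>\<open>C\<close> has at least \<open>card U - R\<close> labels, which is
        more than \<open>R\<close>.\<close>
      then show False using le C(2) U(2) by linarith
    qed
    then show "S \<subseteq> gem_components g - {C}" using S by auto
  next
    assume S': "S \<subseteq> gem_components g - {C}"
    have "C' \<subseteq> U - C" if C': "C' \<in> S" for C'
    proof -
      have "C' \<in> gem_components g" "C' \<noteq> C" using C' S' by auto
      then have "C' \<inter> C = {}"
        using C(1) by (intro disjointD[OF partition_onD2[OF partition_gem_components[of g]]])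
      then show ?thesis using gem_component_subset[OF g' \<open>C' \<in> gem_components g\<close>] by blast
    qed
    then have "\<Union>S \<subseteq> U - C" by (rule Union_least)
    then have "card (\<Union>S) \<le> card (U - C)" using U(1) by (intro card_mono) auto
    also have "\<dots> = card U - card C" using CU U(1) by (meson card_Diff_subset finite_subset)
    finally show "card (\<Union>S) \<le> R" using C(2) by simp
  qed
  have "truncated_sum R p g =
      (\<Sum>S\<in>{S\<in>Pow (gem_components g). card (\<Union>S) \<le> R}. signed_choose p (card S))"
    unfolding truncated_sum_def using fin by (intro sum.inter_filter[symmetric]) auto
  also have "{S\<in>Pow (gem_components g). card (\<Union>S) \<le> R} = Pow (gem_components g - {C})"
    using iff by auto
  also have "(\<Sum>S\<in>\<dots>. signed_choose p (card S)) =
      (if card (gem_components g - {C}) = p then 1 else 0)"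
    using fin by (intro sum_signed_choose) auto
  \<comment> \<open>The large component is never selected, so the inclusion-exclusion runs over one
    component fewer; this explains \<open>m - 1\<close> in the coefficients.\<close>
  also have "card (gem_components g - {C}) = p \<longleftrightarrow> \<pi>\<^sub>0 g = Suc p"
    using card_Suc_Diff1[OF fin C(1)] by (simp add: \<pi>\<^sub>0_def) linarith
  finally show ?thesis .
qed

definition light_unions :: "nat \<Rightarrow> gem \<Rightarrow> nat set set set" where
  "light_unions R g = {S \<in> Pow (gem_components g). card (\<Union>S) \<le> R}"

text \<open>A light union consists of at most \<open>R\<close> components, so the binomial
  coefficient in its weight is at most \<open>2 ^ R\<close>.\<close>

lemma abs_truncated_sum_le:
  assumes "finite U" "g \<in> gems D U"
  shows "\<bar>truncated_sum R p g\<bar> \<le> 2 ^ R * int (card (light_unions R g))"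
proof -
  have fin: "finite (Pow (gem_components g))" using finite_gem_components[OF assms] by simp
  have "\<bar>signed_choose p (card S)\<bar> \<le> 2 ^ R" if "S \<in> light_unions R g" for S
  proof -
    have "card S \<le> R"
      using card_le_card_Union_gem_components[OF assms, of S] that by (auto simp: light_unions_def)
    then have "card S choose p \<le> 2 ^ R"
      by (meson binomial_le_pow2 le_trans one_le_numeral power_increasing)
    then have "int (card S choose p) \<le> 2 ^ R" by (metis of_nat_le_numeral_power_cancel_iff)
    then show ?thesis by (simp add: signed_choose_def abs_mult)
  qed
  then have *: "(\<Sum>S\<in>light_unions R g. \<bar>signed_choose p (card S)\<bar>) \<le> (\<Sum>S\<in>light_unions R g. 2 ^ R)"
    by (rule sum_mono)
  have "truncated_sum R p g = (\<Sum>S\<in>light_unions R g. signed_choose p (card S))"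
    unfolding truncated_sum_def light_unions_def using fin by (intro sum.inter_filter[symmetric])
  also have "\<bar>\<dots>\<bar> \<le> (\<Sum>S\<in>light_unions R g. \<bar>signed_choose p (card S)\<bar>)"
    by (rule sum_abs)
  finally show ?thesis using * by (simp add: mult.commute)
qed

text \<open>Removing a light union with label set \<open>W\<close> from a small GEM leaves a GEM
  that is small for the parameter \<open>R - card W\<close>. Hence \<open>card_small_gems_le\<close>
  bounds the number of possible remainders for each \<open>W\<close>.\<close>

lemma sum_light_unions_le:
  assumes U: "finite U" "3 * R < card U"
  shows "(\<Sum>g\<in>small_gems D U R. card (light_unions R g)) \<le>
    (\<Sum>i\<le>R. (card U choose i) * (card (GEM D i) * split_count D (card U - i) (R - i)))"
proof -
  let ?N = "card U"
  define Q where "Q T \<longleftrightarrow> (\<forall>C\<in>T. card C + R < ?N)" for T :: "nat set set"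
  define f :: "nat set set \<Rightarrow> nat set set \<Rightarrow> nat"
    where "f S T = (if card (\<Union>S) \<le> R \<and> Q T then 1 else 0)" for S T
  define h where "h i = (if i \<le> R then card (GEM D i) * split_count D (?N - i) (R - i) else 0)" for i
  have small: "small_gems D U R \<subseteq> gems D U" by (auto simp: small_gems_def)
  have "(\<Sum>g\<in>small_gems D U R. card (light_unions R g)) \<le>
      (\<Sum>g\<in>small_gems D U R. \<Sum>S\<in>Pow (gem_components g). f S (gem_components g - S))"
  proof (rule sum_mono)
    fix g assume g: "g \<in> small_gems D U R"
    have fin: "finite (Pow (gem_components g))"
      using finite_gem_components[OF U(1), of g D] g small by auto
    have "card (light_unions R g) = (\<Sum>S\<in>Pow (gem_components g). if card (\<Union>S) \<le> R then 1 else 0)"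
      unfolding light_unions_def card_eq_sum using fin by (rule sum.inter_filter)
    also have "\<dots> \<le> (\<Sum>S\<in>Pow (gem_components g). f S (gem_components g - S))"
      using g by (intro sum_mono) (auto simp: f_def Q_def small_gems_def)
    finally show "card (light_unions R g) \<le> \<dots>" .
  qed
  also have "\<dots> \<le> (\<Sum>g\<in>gems D U. \<Sum>S\<in>Pow (gem_components g). f S (gem_components g - S))"
    using small finite_gems[OF U(1)] by (intro sum_mono2) auto
  also have "\<dots> = (\<Sum>W\<in>Pow U. \<Sum>g'\<in>gems D W. \<Sum>g''\<in>gems D (U - W).
      f (gem_components g') (gem_components g''))"
    by (rule sum_gem_component_splits[OF U(1)])
  also have "\<dots> \<le> (\<Sum>W\<in>Pow U. h (card W))"
  proof (rule sum_mono)
    fix W assume W: "W \<in> Pow U"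
    then have fin: "finite W" "finite (U - W)" using U(1) finite_subset by auto
    have card: "card (U - W) = ?N - card W" "card W \<le> ?N"
      using W fin U(1) by (auto simp: card_Diff_subset intro: card_mono)
    show "(\<Sum>g'\<in>gems D W. \<Sum>g''\<in>gems D (U - W). f (gem_components g') (gem_components g'')) \<le> h (card W)"
    proof (cases "card W \<le> R")
      case True
      have "(\<Sum>g''\<in>gems D (U - W). f (gem_components g') (gem_components g'')) \<le>
          split_count D (?N - card W) (R - card W)" if g': "g' \<in> gems D W" for g'
      proof -
        have "(\<Sum>g''\<in>gems D (U - W). f (gem_components g') (gem_components g'')) =
            (\<Sum>g''\<in>gems D (U - W). if Q (gem_components g'') then 1 else 0)"
          using True by (simp add: f_def Union_gem_components[OF g'])
        also have "\<dots> = card {g''\<in>gems D (U - W). Q (gem_components g'')}"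
          unfolding card_eq_sum using finite_gems[OF fin(2)] by (rule sum.inter_filter[symmetric])
        \<comment> \<open>The condition \<open>card C + R < ?N\<close> is unchanged when
          \<open>card W\<close> is subtracted from both \<open>R\<close> and
          \<open>?N\<close>.\<close>
        also have "\<dots> \<le> card (small_gems D (U - W) (R - card W))"
          using finite_gems[OF fin(2)] True card
          by (intro card_mono) (auto simp: small_gems_def Q_def)
        also have "\<dots> \<le> split_count D (card (U - W)) (R - card W)"
          using U(2) True card by (intro card_small_gems_le[OF fin(2)]) auto
        finally show ?thesis by (simp only: card)
      qed
      then have "(\<Sum>g'\<in>gems D W. \<Sum>g''\<in>gems D (U - W). f (gem_components g') (gem_components g'')) \<le>
          (\<Sum>g'\<in>gems D W. split_count D (?N - card W) (R - card W))"
        by (rule sum_mono)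
      also have "\<dots> = h (card W)"
        using True card_gems_cong_card[OF fin(1), of "{1..card W}" D] by (simp add: h_def)
      finally show ?thesis .
    next
      case False
      then show ?thesis by (simp add: f_def Union_gem_components)
    qed
  qed
  also have "\<dots> = (\<Sum>i\<le>?N. (?N choose i) * h i)"
    using sum_Pow_card[OF U(1), of h] by simp
  also have "\<dots> = (\<Sum>i\<le>R. (?N choose i) * (card (GEM D i) * split_count D (?N - i) (R - i)))"
    using U(2) by (intro sum.mono_neutral_cong_right) (auto simp: h_def)
  finally show ?thesis .
qed

lemma sum_truncated_sum:
  assumes "finite U"
  shows "(\<Sum>g\<in>gems D U. truncated_sum R p g) =
    (\<Sum>i\<le>card U. int (card U choose i) * ((if i \<le> R then 1 else 0) *
       (\<Sum>g\<in>GEM D i. signed_choose p (\<pi>\<^sub>0 g)) * int (card (GEM D (card U - i)))))"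
proof -
  have "(\<Sum>g\<in>gems D U. truncated_sum R p g) = (\<Sum>W\<in>Pow U. \<Sum>g'\<in>gems D W. \<Sum>g''\<in>gems D (U - W).
      if card (\<Union>(gem_components g')) \<le> R then signed_choose p (card (gem_components g')) else 0)"
    unfolding truncated_sum_def
    by (rule sum_gem_component_splits[OF assms,
          where f = "\<lambda>S T. if card (\<Union>S) \<le> R then signed_choose p (card S) else 0"])
  also have "\<dots> = (\<Sum>W\<in>Pow U. \<Sum>g'\<in>gems D W. \<Sum>g''\<in>gems D (U - W).
      (if card W \<le> R then 1 else 0) * signed_choose p (\<pi>\<^sub>0 g'))"
    by (intro sum.cong refl) (auto simp: Union_gem_components \<pi>\<^sub>0_def)
  also note sum_gem_pairs_card[OF assms, where F = "\<lambda>i. if i \<le> R then 1 else 0" and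
      \<phi> = "signed_choose p" and D = D]
  finally show ?thesis .
qed

text \<open>Only small GEMs contribute to the difference. For these the empty union is light, so the
  indicator is bounded by the number of light unions, which accounts for the summand
  \<open>1\<close> in the factor.\<close>

lemma abs_count_minus_truncated_sum_le:
  assumes U: "finite U" "3 * R < card U"
  shows "\<bar>int (card {g\<in>gems D U. \<pi>\<^sub>0 g = Suc p}) - (\<Sum>g\<in>gems D U. truncated_sum R p g)\<bar> \<le>
    (1 + 2 ^ R) * int (\<Sum>g\<in>small_gems D U R. card (light_unions R g))"
proof -
  let ?e = "\<lambda>g. (if \<pi>\<^sub>0 g = Suc p then 1 else 0) - truncated_sum R p g"
  have small: "small_gems D U R \<subseteq> gems D U" by (auto simp: small_gems_def)
  note fin = finite_gems[OF U(1), of D]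
  have "int (card {g\<in>gems D U. \<pi>\<^sub>0 g = Suc p}) = (\<Sum>g\<in>gems D U. if \<pi>\<^sub>0 g = Suc p then 1 else 0)"
    using sum.inter_filter[OF fin, of "\<lambda>_. 1::int" "\<lambda>g. \<pi>\<^sub>0 g = Suc p"] by simp
  then have "int (card {g\<in>gems D U. \<pi>\<^sub>0 g = Suc p}) - (\<Sum>g\<in>gems D U. truncated_sum R p g) =
      (\<Sum>g\<in>gems D U. ?e g)"
    by (simp only: sum_subtractf)
  also have "\<dots> = (\<Sum>g\<in>small_gems D U R. ?e g)"
    using small fin U by (intro sum.mono_neutral_right) (auto simp: truncated_sum_not_small)
  also have "\<bar>\<dots>\<bar> \<le> (\<Sum>g\<in>small_gems D U R. (1 + 2 ^ R) * int (card (light_unions R g)))"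
  proof (rule order_trans[OF sum_abs sum_mono])
    fix g assume g: "g \<in> small_gems D U R"
    then have g': "g \<in> gems D U" using small by auto
    have "{} \<in> light_unions R g" "finite (light_unions R g)"
      using finite_gem_components[OF U(1) g'] by (auto simp: light_unions_def)
    then have "1 \<le> card (light_unions R g)" by (auto simp: Suc_le_eq card_gt_0_iff)
    then show "\<bar>?e g\<bar> \<le> (1 + 2 ^ R) * int (card (light_unions R g))"
      using abs_truncated_sum_le[OF U(1) g', of R p] by (auto simp: algebra_simps abs_if split: if_splits)
  qed
  finally show ?thesis by (simp add: sum_distrib_left)
qed

lemma GEM_odd: "odd N \<Longrightarrow> GEM D N = {}"
  by (intro gems_odd) auto

lemma abs_count_minus_expansion_le:
  assumes "3 * r < n" "m \<ge> 1"
  shows "\<bar>int (card {g\<in>GEM D (2 * n). \<pi>\<^sub>0 g = m}) -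
      (\<Sum>k\<le>r. \<dd> D (2 * k) m * int (((2 * n) choose (2 * k)) * card (GEM D (2 * (n - k)))))\<bar> \<le>
    (1 + 2 ^ (2 * r)) * int (\<Sum>k\<le>r. ((2 * n) choose (2 * k)) *
      (card (GEM D (2 * k)) * split_count D (2 * (n - k)) (2 * (r - k))))"
proof -
  have U: "finite {1..2 * n}" "3 * (2 * r) < card {1..2 * n}" "card {1..2 * n} = 2 * n"
    using assms by auto
  have m: "Suc (m - 1) = m" using assms by simp
  have "(\<Sum>g\<in>GEM D (2 * n). truncated_sum (2 * r) (m - 1) g) =
    (\<Sum>i\<le>2 * n. int (2 * n choose i) * ((if i \<le> 2 * r then 1 else 0) *
       \<dd> D i m * int (card (GEM D (2 * n - i)))))"
    using sum_truncated_sum[OF U(1), of "2 * r" "m - 1" D] by (simp only: U dd_eq_sum_signed_choose)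
  also have "\<dots> = (\<Sum>k\<le>r. int (2 * n choose (2 * k)) * ((if 2 * k \<le> 2 * r then 1 else 0) *
       \<dd> D (2 * k) m * int (card (GEM D (2 * n - 2 * k)))))"
    using assms(1) by (intro sum_even_indices) (auto simp: dd_eq_sum_signed_choose GEM_odd simp del: One_nat_def)
  also have "\<dots> = (\<Sum>k\<le>r. \<dd> D (2 * k) m * int (((2 * n) choose (2 * k)) * card (GEM D (2 * (n - k)))))"
    by (intro sum.cong) (auto simp: diff_mult_distrib2)
  finally have 1: "(\<Sum>g\<in>GEM D (2 * n). truncated_sum (2 * r) (m - 1) g) = \<dots>" .
  have "(\<Sum>i\<le>2 * r. (2 * n choose i) * (card (GEM D i) * split_count D (2 * n - i) (2 * r - i))) =
      (\<Sum>k\<le>r. ((2 * n) choose (2 * k)) *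
        (card (GEM D (2 * k)) * split_count D (2 * n - 2 * k) (2 * r - 2 * k)))"
  proof -
    \<comment> \<open>The explicit cut-off provides the vanishing beyond \<open>2 * r\<close> that
      \<open>sum_even_indices\<close> asks for.\<close>
    let ?h = "\<lambda>i. if i \<le> 2 * r then (2 * n choose i) *
      (card (GEM D i) * split_count D (2 * n - i) (2 * r - i)) else 0"
    have "(\<Sum>i\<le>2 * r. ?h i) = (\<Sum>k\<le>r. ?h (2 * k))"
      by (intro sum_even_indices) (auto simp: GEM_odd simp del: One_nat_def)
    then show ?thesis by simp
  qed
  then have 2: "(\<Sum>i\<le>2 * r. (2 * n choose i) * (card (GEM D i) * split_count D (2 * n - i) (2 * r - i))) =
      (\<Sum>k\<le>r. ((2 * n) choose (2 * k)) *
        (card (GEM D (2 * k)) * split_count D (2 * (n - k)) (2 * (r - k))))"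
    by (simp only: diff_mult_distrib2)
  have "\<bar>int (card {g\<in>GEM D (2 * n). \<pi>\<^sub>0 g = m}) - (\<Sum>g\<in>GEM D (2 * n). truncated_sum (2 * r) (m - 1) g)\<bar> \<le>
      (1 + 2 ^ (2 * r)) * int (\<Sum>g\<in>small_gems D {1..2 * n} (2 * r). card (light_unions (2 * r) g))"
    using abs_count_minus_truncated_sum_le[OF U(1,2), of D "m - 1"] by (simp only: m)
  also have "\<dots> \<le> (1 + 2 ^ (2 * r)) * int (\<Sum>i\<le>2 * r. (2 * n choose i) *
      (card (GEM D i) * split_count D (2 * n - i) (2 * r - i)))"
    using sum_light_unions_le[OF U(1,2), of D] by (intro mult_left_mono of_nat_mono) (simp_all only: U, simp)
  finally show ?thesis unfolding 1 2 .
qed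

subsection \<open>Growth of the scale\<close>

text \<open>The number of perfect matchings of \<open>2 * n\<close> labels, as a real
  number.\<close>

definition odd_fact :: "nat \<Rightarrow> real" where
  "odd_fact n = real (double_fact (2 * n - 1))"

lemma odd_fact_0 [simp]: "odd_fact 0 = 1"
  by (simp add: odd_fact_def)

lemma odd_fact_Suc: "odd_fact (Suc n) = (2 * real n + 1) * odd_fact n"
  by (cases n) (simp_all add: odd_fact_def algebra_simps)

lemma odd_fact_pos: "odd_fact n > 0"
  by (induction n) (simp_all add: odd_fact_Suc)

lemma card_GEM: "real (card (GEM D (2 * n))) = odd_fact n ^ (D + 1)"
  using card_gems[of "{1..2 * n}" n D] by (simp add: odd_fact_def)

lemma choose_Suc_Suc_mult:
  assumes "k + 2 \<le> N"
  shows "real (N choose (k + 2)) * (real k + 2) * (real k + 1) =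
    real (N choose k) * (real N - real k) * (real N - real k - 1)"
proof -
  have absorb: "real (N choose Suc i) * real (Suc i) = real (N choose i) * (real N - real i)" if "i \<le> N" for i
  proof -
    have "Suc i * (N choose Suc i) = (N - i) * (N choose i)"
      by (simp only: binomial_absorption binomial_absorb_comp)
    then have "real (Suc i * (N choose Suc i)) = real ((N - i) * (N choose i))" by (rule arg_cong)
    then show ?thesis using that by (simp only: of_nat_mult of_nat_diff mult.commute)
  qed
  have "real (N choose (k + 2)) * (real k + 2) * (real k + 1) =
      (real (N choose Suc (Suc k)) * real (Suc (Suc k))) * (real k + 1)"
    by simp
  also have "\<dots> = (real (N choose Suc k) * real (Suc k)) * (real N - real k - 1)"
    using absorb[of "Suc k"] assms by (simp, simp add: algebra_simps)
  also have "\<dots> = real (N choose k) * (real N - real k) * (real N - real k - 1)"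
    using absorb[of k] assms by simp
  finally show ?thesis .
qed

section \<open>Decay of the number of splittings into \<open>2 * j\<close> and
  \<open>2 * (n - j)\<close> labels\<close>

definition split_term :: "nat \<Rightarrow> nat \<Rightarrow> nat \<Rightarrow> real" where
  "split_term D n j = real ((2 * n) choose (2 * j)) * (odd_fact j * odd_fact (n - j)) ^ (D + 1)"

lemma split_term_nonneg: "split_term D n j \<ge> 0"
  using odd_fact_pos by (simp add: split_term_def less_imp_le)

lemma split_term_sym:
  assumes "j \<le> n"
  shows "split_term D n (n - j) = split_term D n j"
proof -
  have "(2 * n) choose (2 * (n - j)) = (2 * n) choose (2 * j)"
    using binomial_symmetric[of "2 * j" "2 * n"] assms by (simp add: diff_mult_distrib2)
  then show ?thesis using assms by (simp add: split_term_def mult.commute)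
qed

text \<open>With \<open>p = 2 * j + 1\<close> and \<open>q = 2 * (n - j) - 1\<close> the ratio of
  consecutive terms is \<open>(q + 1) / (p + 1) * (p / q) ^ D\<close>. As \<open>p \<le> q\<close>,
  the first factor is at most \<open>q / p\<close>, so for \<open>D \<ge> 2\<close> the ratio is at
  most \<open>p / q\<close>.\<close>

lemma split_term_Suc_le:
  assumes "D \<ge> 2" "2 * j < n"
  shows "split_term D n (Suc j) * (2 * real (n - j) - 1) \<le> split_term D n j * (2 * real j + 1)"
proof -
  define p q where "p = 2 * real j + 1" and "q = 2 * real (n - j) - 1"
  define l where "l = n - Suc j"
  obtain e where D: "D = Suc (Suc e)" using assms(1) by (metis Suc_le_D numeral_2_eq_2 Suc_le_mono)
  have nj: "n - j = Suc l" using assms(2) by (simp add: l_def)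
  have q: "q = 2 * real l + 1" by (simp add: q_def nj)
  have pq: "1 \<le> p" "p \<le> q" using assms(2) by (auto simp: p_def q l_def of_nat_diff)
  have C: "real ((2 * n) choose (2 * Suc j)) * ((p + 1) * p) = real ((2 * n) choose (2 * j)) * ((q + 1) * q)"
  proof -
    have "real (2 * n) - real (2 * j) = q + 1" using assms(2) by (simp add: q_def of_nat_diff)
    then show ?thesis
      using choose_Suc_Suc_mult[of "2 * j" "2 * n"] assms(2) by (simp add: p_def mult.assoc add.commute)
  qed
  define w where "w = odd_fact j * odd_fact l"
  have w: "w > 0" using odd_fact_pos by (simp add: w_def)
  have Suc: "split_term D n (Suc j) = real ((2 * n) choose (2 * Suc j)) * (p * w) ^ (D + 1)"
    by (simp add: split_term_def odd_fact_Suc p_def w_def l_def mult.assoc del: mult_Suc_right)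
  have cur: "split_term D n j = real ((2 * n) choose (2 * j)) * (q * w) ^ (D + 1)"
    by (simp add: split_term_def nj odd_fact_Suc q w_def mult_ac)
  have "(q + 1) * p \<le> (p + 1) * q" using pq by (simp add: algebra_simps)
  then have key: "(q + 1) * p * p ^ e \<le> (p + 1) * q * q ^ e"
    by (rule mult_mono[OF _ power_mono]) (use pq in auto)
  \<comment> \<open>Both sides are multiplied by \<open>(p + 1) * p\<close>, the denominator in the
    recursion of the binomial coefficients, and this factor is cancelled at the end.\<close>
  have "split_term D n (Suc j) * q * ((p + 1) * p) =
      (real ((2 * n) choose (2 * Suc j)) * ((p + 1) * p)) * q * (p * w) ^ (D + 1)"
    by (simp add: Suc)
  also have "\<dots> = real ((2 * n) choose (2 * j)) * w ^ (D + 1) * q ^ 2 * p ^ 2 * ((q + 1) * p * p ^ e)"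
    unfolding C by (simp add: D power_mult_distrib power2_eq_square)
  also have "\<dots> \<le> real ((2 * n) choose (2 * j)) * w ^ (D + 1) * q ^ 2 * p ^ 2 * ((p + 1) * q * q ^ e)"
    using w by (intro mult_left_mono key) auto
  also have "\<dots> = split_term D n j * p * ((p + 1) * p)"
    unfolding cur by (simp add: D power_mult_distrib power2_eq_square)
  finally show ?thesis using pq unfolding p_def[symmetric] q_def[symmetric]
    by (subst (asm) mult_le_cancel_right_pos) auto
qed

text \<open>The terms decrease up to the middle \<open>n / 2\<close>. Beyond it, \<open>j\<close> is
  reflected to \<open>n - j\<close>, which is still at least \<open>i\<close> because
  \<open>i + j \<le> n\<close>.\<close>

lemma split_term_antimono:
  assumes "D \<ge> 2" "i \<le> j" "i + j \<le> n"
  shows "split_term D n j \<le> split_term D n i"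
proof -
  have *: "split_term D n j \<le> split_term D n i" if "i \<le> j" "2 * j \<le> n" for j
    using that
  proof (induction j rule: dec_induct)
    case (step j)
    have "split_term D n (Suc j) * (2 * real (n - j) - 1) \<le> split_term D n j * (2 * real j + 1)"
      using step.prems by (intro split_term_Suc_le assms(1)) auto
    also have "\<dots> \<le> split_term D n j * (2 * real (n - j) - 1)"
      using step.prems by (intro mult_left_mono split_term_nonneg) auto
    finally have "split_term D n (Suc j) \<le> split_term D n j"
      using step.prems by (subst (asm) mult_le_cancel_right_pos) auto
    also have "\<dots> \<le> split_term D n i" using step by auto
    finally show ?case .
  qed simp
  show ?thesis
  proof (cases "2 * j \<le> n")
    case False
    have "split_term D n (n - j) \<le> split_term D n i"
      using False assms by (intro *) auto
    then show ?thesis using assms by (simp add: split_term_sym)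
  qed (use * assms in auto)
qed

lemma split_count_even:
  "real (split_count D (2 * n) (2 * r)) = (\<Sum>j | r < j \<and> j + r < n. split_term D n j)"
proof -
  let ?h = "\<lambda>i. ((2 * n) choose i) * (card (GEM D i) * card (GEM D (2 * n - i)))"
  have "split_count D (2 * n) (2 * r) = sum ?h ((*) 2 ` {j. r < j \<and> j + r < n})"
    unfolding split_count_def
  proof (rule sum.mono_neutral_right)
    show "finite {i. 2 * r < i \<and> i + 2 * r < 2 * n}" by (rule finite_subset[of _ "{..2 * n}"]) auto
    show "\<forall>i\<in>{i. 2 * r < i \<and> i + 2 * r < 2 * n} - (*) 2 ` {j. r < j \<and> j + r < n}. ?h i = 0"
    proof
      fix i assume i: "i \<in> {i. 2 * r < i \<and> i + 2 * r < 2 * n} - (*) 2 ` {j. r < j \<and> j + r < n}"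
      have "odd i"
      proof
        assume "even i"
        then obtain j where "i = 2 * j" by (auto elim: evenE)
        then show False using i by auto
      qed
      then show "?h i = 0"
        using GEM_odd[OF \<open>odd i\<close>, of D] by (simp only: card.empty mult_0 mult_0_right)
    qed
  qed auto
  also have "\<dots> = (\<Sum>j | r < j \<and> j + r < n. ?h (2 * j))"
    by (subst sum.reindex) (auto simp: inj_on_def)
  finally have "real (split_count D (2 * n) (2 * r)) = (\<Sum>j | r < j \<and> j + r < n. real (?h (2 * j)))"
    by (simp only: of_nat_sum)
  also have "\<dots> = (\<Sum>j | r < j \<and> j + r < n. split_term D n j)"
  proof (rule sum.cong[OF refl])
    fix j assume "j \<in> {j. r < j \<and> j + r < n}"
    have "real (?h (2 * j)) =
        real ((2 * n) choose (2 * j)) * (real (card (GEM D (2 * j))) * real (card (GEM D (2 * (n - j)))))"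
      by (simp only: of_nat_mult diff_mult_distrib2)
    then show "real (?h (2 * j)) = split_term D n j"
      unfolding card_GEM split_term_def by (simp only: power_mult_distrib)
  qed
  finally show ?thesis .
qed

text \<open>The two extreme terms dominate: each of the others is smaller by a factor of order \<open>n\<close>.\<close>

lemma split_count_le:
  assumes D: "D \<ge> 2" and n: "2 * r + 3 \<le> n"
  shows "real (split_count D (2 * n) (2 * r)) \<le> (2 * real r + 5) * split_term D n (Suc r)"
proof -
  let ?J = "{j. r < j \<and> j + r < n}" and ?E = "{Suc r, n - Suc r}" and ?t = "split_term D n"
  have fin: "finite ?J" by (rule finite_subset[of _ "{..n}"]) auto
  have EJ: "?E \<subseteq> ?J" using n by auto
  have inner: "?t j \<le> (2 * real r + 3) / real n * ?t (Suc r)" if j: "j \<in> ?J - ?E" for j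
  proof -
    have "?t j \<le> ?t (Suc (Suc r))"
      using j by (intro split_term_antimono D) auto
    \<comment> \<open>\<open>2 * r + 3 \<le> n\<close> says precisely that \<open>n\<close> is at
      most the factor \<open>2 * (n - Suc r) - 1\<close> of \<open>split_term_Suc_le\<close> at the
      index \<open>Suc r\<close>.\<close>
    then have "?t j * real n \<le> ?t (Suc (Suc r)) * (2 * real (n - Suc r) - 1)"
      using n split_term_nonneg[of D n] by (intro mult_mono) (auto simp: of_nat_diff)
    also have "\<dots> \<le> ?t (Suc r) * (2 * real (Suc r) + 1)"
      using n by (intro split_term_Suc_le D) auto
    finally show ?thesis using n by (simp add: field_simps)
  qed
  have "real (split_count D (2 * n) (2 * r)) = sum ?t (?J - ?E) + sum ?t ?E"
    unfolding split_count_even by (rule sum.subset_diff[OF EJ fin])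
  \<comment> \<open>The two extreme terms contribute \<open>2\<close> and the fewer than
    \<open>n\<close> others \<open>2 * r + 3\<close> to the constant
    \<open>2 * r + 5\<close>.\<close>
  also have "sum ?t ?E \<le> 2 * ?t (Suc r)"
    using split_term_sym[of "Suc r" n D] n split_term_nonneg[of D n "Suc r"]
    by (cases "n - Suc r = Suc r") auto
  also have "sum ?t (?J - ?E) \<le> real (card (?J - ?E)) * ((2 * real r + 3) / real n * ?t (Suc r))"
    by (rule sum_bounded_above[OF inner])
  also have "\<dots> \<le> real n * ((2 * real r + 3) / real n * ?t (Suc r))"
  proof (rule mult_right_mono)
    have "?J - ?E \<subseteq> {..<n}" by auto
    then have "card (?J - ?E) \<le> card {..<n}" by (rule card_mono[rotated]) simp
    then show "real (card (?J - ?E)) \<le> real n" by simp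
  qed (simp add: split_term_nonneg)
  also have "real n * ((2 * real r + 3) / real n * ?t (Suc r)) = (2 * real r + 3) * ?t (Suc r)"
    using n by simp
  finally show ?thesis by (simp add: algebra_simps)
qed

section \<open>Comparison with the scale functions\<close>

lemma gem_scale_eq: "gem_scale D k n = real ((2 * n) choose (2 * k)) * (odd_fact (n - k) / odd_fact n) ^ (D + 1)"
  by (simp add: gem_scale_def odd_fact_def)

lemma gem_scale_nonneg: "gem_scale D k n \<ge> 0"
  using odd_fact_pos by (simp add: gem_scale_eq less_imp_le)

text \<open>With \<open>p = 2 * k + 1\<close> and \<open>q = 2 * (n - k) - 1\<close> the ratio of
  consecutive scale functions is \<open>(q + 1) / ((p + 1) * p * q ^ D)\<close>, and
  \<open>q + 1 \<le> 2 * q\<close> makes this at most \<open>2 / q\<close> for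
  \<open>D \<ge> 2\<close>.\<close>

lemma gem_scale_Suc_le:
  assumes "D \<ge> 2" "k < n"
  shows "gem_scale D (Suc k) n * (2 * real (n - k) - 1) \<le> 2 * gem_scale D k n"
proof -
  define p q where "p = 2 * real k + 1" and "q = 2 * real (n - k) - 1"
  define l where "l = n - Suc k"
  obtain e where D: "D = Suc (Suc e)" using assms(1) by (metis Suc_le_D numeral_2_eq_2 Suc_le_mono)
  have nk: "n - k = Suc l" using assms(2) by (simp add: l_def)
  have q: "q = 2 * real l + 1" by (simp add: q_def nk)
  have p1: "1 \<le> p" and q1: "1 \<le> q" by (auto simp: p_def q)
  have C: "real ((2 * n) choose (2 * Suc k)) * ((p + 1) * p) = real ((2 * n) choose (2 * k)) * ((q + 1) * q)"
  proof -
    have "real (2 * n) - real (2 * k) = q + 1" using assms(2) by (simp add: q_def of_nat_diff)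
    then show ?thesis
      using choose_Suc_Suc_mult[of "2 * k" "2 * n"] assms(2) by (simp add: p_def mult.assoc add.commute)
  qed
  define w where "w = odd_fact l / odd_fact n"
  have w: "w > 0" using odd_fact_pos by (simp add: w_def)
  have Suc: "gem_scale D (Suc k) n = real ((2 * n) choose (2 * Suc k)) * w ^ (D + 1)"
    by (simp add: gem_scale_eq w_def l_def del: mult_Suc_right)
  have cur: "gem_scale D k n = real ((2 * n) choose (2 * k)) * (q * w) ^ (D + 1)"
    by (simp add: gem_scale_eq nk odd_fact_Suc q w_def)
  have "1 \<le> (p + 1) * p" using p1 mult_mono[of 1 "p + 1" 1 p] by simp
  then have "gem_scale D (Suc k) n \<le> gem_scale D (Suc k) n * ((p + 1) * p)"
    using mult_left_mono[of 1 "(p + 1) * p" "gem_scale D (Suc k) n"] gem_scale_nonneg by simp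
  then have "gem_scale D (Suc k) n * q \<le> gem_scale D (Suc k) n * ((p + 1) * p) * q"
    using q1 by (intro mult_right_mono) auto
  also have "\<dots> = real ((2 * n) choose (2 * k)) * w ^ (D + 1) * q ^ 2 * (q + 1)"
    unfolding Suc using C by (simp add: power2_eq_square mult_ac)
  also have "\<dots> \<le> real ((2 * n) choose (2 * k)) * w ^ (D + 1) * q ^ 2 * (2 * (q * q ^ e))"
  proof (rule mult_left_mono)
    have "q + 1 \<le> 2 * q" using q1 by simp
    also have "\<dots> \<le> 2 * (q * q ^ e)" using q1 one_le_power[OF q1, of e] by simp
    finally show "q + 1 \<le> 2 * (q * q ^ e)" .
  qed (use w in auto)
  also have "\<dots> = 2 * gem_scale D k n"
    unfolding cur by (simp add: D power_mult_distrib power2_eq_square)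
  finally show ?thesis unfolding q_def .
qed

lemma gem_scale_Suc_smallo:
  assumes "D \<ge> 2"
  shows "gem_scale D (Suc k) \<in> o(gem_scale D k)"
proof (rule landau_o.smallI)
  fix c :: real assume c: "c > 0"
  obtain n0 :: nat where n0: "2 / c < real n0" using reals_Archimedean2 by blast
  show "\<forall>\<^sub>F n in sequentially. norm (gem_scale D (Suc k) n) \<le> c * norm (gem_scale D k n)"
    using eventually_ge_at_top[of "n0 + k + 1"]
  proof eventually_elim
    case (elim n)
    then have "real n0 \<le> 2 * real (n - k) - 1" by (simp add: of_nat_diff)
    then have "2 / c \<le> 2 * real (n - k) - 1" using n0 by linarith
    then have "gem_scale D (Suc k) n * (2 / c) \<le> gem_scale D (Suc k) n * (2 * real (n - k) - 1)"
      by (intro mult_left_mono gem_scale_nonneg)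
    also have "\<dots> \<le> 2 * gem_scale D k n" using elim by (intro gem_scale_Suc_le assms) auto
    finally show ?case using c by (simp add: gem_scale_nonneg field_simps)
  qed
qed

text \<open>The removed union has \<open>2 * k\<close> labels and the smallest possible part of the
  remainder \<open>2 * (r - k) + 2\<close>. Together these are \<open>2 * (r + 1)\<close> labels, so
  the product of binomial coefficients regroups into the scale function of index
  \<open>Suc r\<close>, up to a constant independent of \<open>n\<close>.\<close>

lemma choose_mult_split_count_le:
  assumes D: "D \<ge> 2" and n: "2 * r + 3 \<le> n" and k: "k \<le> r"
  shows "real (((2 * n) choose (2 * k)) * (card (GEM D (2 * k)) * split_count D (2 * (n - k)) (2 * (r - k)))) \<le>
    (real ((2 * r + 2) choose (2 * k)) * odd_fact k ^ (D + 1) * (2 * real (r - k) + 5) *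
       odd_fact (Suc (r - k)) ^ (D + 1)) * (gem_scale D (Suc r) n * odd_fact n ^ (D + 1))"
proof -
  have "((2 * n) choose (2 * k)) * ((2 * n - 2 * k) choose (2 * r + 2 - 2 * k)) =
      ((2 * n) choose (2 * r + 2)) * ((2 * r + 2) choose (2 * k))"
    using n k by (intro choose_mult[symmetric]) auto
  moreover have "2 * r + 2 - 2 * k = 2 * Suc (r - k)" "2 * n - 2 * k = 2 * (n - k)" "2 * r + 2 = 2 * Suc r"
    using k by auto
  ultimately have C: "real ((2 * n) choose (2 * k)) * real ((2 * (n - k)) choose (2 * Suc (r - k))) =
      real ((2 * n) choose (2 * Suc r)) * real ((2 * r + 2) choose (2 * k))"
    by (simp only: of_nat_mult[symmetric])
  have "n - k - Suc (r - k) = n - Suc r" using k by auto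
  then have t: "split_term D (n - k) (Suc (r - k)) = real ((2 * (n - k)) choose (2 * Suc (r - k))) *
      (odd_fact (Suc (r - k)) * odd_fact (n - Suc r)) ^ (D + 1)"
    by (simp only: split_term_def)
  have scale: "gem_scale D (Suc r) n * odd_fact n ^ (D + 1) =
      real ((2 * n) choose (2 * Suc r)) * odd_fact (n - Suc r) ^ (D + 1)"
    using odd_fact_pos[of n] by (simp add: gem_scale_eq power_divide)
  have "real (((2 * n) choose (2 * k)) * (card (GEM D (2 * k)) * split_count D (2 * (n - k)) (2 * (r - k)))) =
      real ((2 * n) choose (2 * k)) * odd_fact k ^ (D + 1) * real (split_count D (2 * (n - k)) (2 * (r - k)))"
    by (simp only: of_nat_mult card_GEM mult.assoc)
  also have "\<dots> \<le> real ((2 * n) choose (2 * k)) * odd_fact k ^ (D + 1) *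
      ((2 * real (r - k) + 5) * split_term D (n - k) (Suc (r - k)))"
    using n k odd_fact_pos[of k] by (intro mult_left_mono split_count_le D) auto
  also have "\<dots> = (real ((2 * n) choose (2 * k)) * real ((2 * (n - k)) choose (2 * Suc (r - k)))) *
      (odd_fact k ^ (D + 1) * (2 * real (r - k) + 5) * odd_fact (Suc (r - k)) ^ (D + 1) *
        odd_fact (n - Suc r) ^ (D + 1))"
    unfolding t power_mult_distrib by (simp only: mult_ac)
  also have "\<dots> = (real ((2 * r + 2) choose (2 * k)) * odd_fact k ^ (D + 1) * (2 * real (r - k) + 5) *
       odd_fact (Suc (r - k)) ^ (D + 1)) * (gem_scale D (Suc r) n * odd_fact n ^ (D + 1))"
    unfolding C scale by (simp only: mult_ac)
  finally show ?thesis .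
qed

lemma prob_GEM:
  "measure_pmf.prob (pmf_of_set (GEM D (2 * n))) {g. \<pi>\<^sub>0 g = m} =
    real (card {g\<in>GEM D (2 * n). \<pi>\<^sub>0 g = m}) / odd_fact n ^ (D + 1)"
proof -
  have "GEM D (2 * n) \<inter> {g. \<pi>\<^sub>0 g = m} = {g\<in>GEM D (2 * n). \<pi>\<^sub>0 g = m}" by auto
  then show ?thesis
    using measure_pmf_of_set[OF GEM_nonempty finite_gems, of n D "{g. \<pi>\<^sub>0 g = m}"]
    by (simp only: card_GEM finite_atLeastAtMost)
qed

theorem proposition4p16:
  fixes D m :: nat
  assumes "D \<ge> 2" and "m \<ge> 1"
  shows "asymptotic_expansion
           (\<lambda>n. measure_pmf.prob (pmf_of_set (GEM D (2 * n))) {g. \<pi>\<^sub>0 g = m})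
           (\<lambda>k. of_int (\<dd> D (2 * k) m))
           (gem_scale D)"
  unfolding asymptotic_expansion_def
proof (intro conjI allI)
  fix r :: nat
  define K where "K k = real ((2 * r + 2) choose (2 * k)) * odd_fact k ^ (D + 1) *
      (2 * real (r - k) + 5) * odd_fact (Suc (r - k)) ^ (D + 1)" for k
  let ?p = "\<lambda>n. measure_pmf.prob (pmf_of_set (GEM D (2 * n))) {g. \<pi>\<^sub>0 g = m}"
  let ?S = "\<lambda>n. \<Sum>k\<le>r. \<dd> D (2 * k) m * int (((2 * n) choose (2 * k)) * card (GEM D (2 * (n - k))))"
  show "(\<lambda>n. ?p n - (\<Sum>k\<le>r. of_int (\<dd> D (2 * k) m) * gem_scale D k n)) \<in> O(gem_scale D (Suc r))"
  proof (rule bigoI)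
    show "\<forall>\<^sub>F n in sequentially. norm (?p n - (\<Sum>k\<le>r. of_int (\<dd> D (2 * k) m) * gem_scale D k n)) \<le>
        ((1 + 2 ^ (2 * r)) * (\<Sum>k\<le>r. K k)) * norm (gem_scale D (Suc r) n)"
      \<comment> \<open>This ensures both \<open>3 * r < n\<close> for the combinatorial estimate
        and \<open>2 * r + 3 \<le> n\<close> for the bound on the splittings.\<close>
      using eventually_ge_at_top[of "3 * r + 3"]
    proof eventually_elim
      case (elim n)
      let ?a = "odd_fact n ^ (D + 1)"
      have a: "?a > 0" using odd_fact_pos by simp
      \<comment> \<open>Division by the number \<open>?a\<close> of all GEMs of size
        \<open>2 * n\<close> turns the weighted counts into the terms of the expansion.\<close>
      have "of_int (\<dd> D (2 * k) m * int (((2 * n) choose (2 * k)) * card (GEM D (2 * (n - k))))) / ?a =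
          of_int (\<dd> D (2 * k) m) * gem_scale D k n" for k
        by (simp only: of_int_mult of_int_of_nat_eq of_nat_mult card_GEM gem_scale_eq power_divide) simp
      then have S: "(\<Sum>k\<le>r. of_int (\<dd> D (2 * k) m) * gem_scale D k n) = of_int (?S n) / ?a"
        by (simp only: of_int_sum sum_divide_distrib)
      have "\<bar>real (card {g\<in>GEM D (2 * n). \<pi>\<^sub>0 g = m}) - of_int (?S n)\<bar> =
          of_int \<bar>int (card {g\<in>GEM D (2 * n). \<pi>\<^sub>0 g = m}) - ?S n\<bar>"
        by (simp only: of_int_abs of_int_diff of_int_of_nat_eq)
      also have "\<dots> \<le> of_int ((1 + 2 ^ (2 * r)) * int (\<Sum>k\<le>r. ((2 * n) choose (2 * k)) *
          (card (GEM D (2 * k)) * split_count D (2 * (n - k)) (2 * (r - k)))))"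
        using elim assms(2) by (subst of_int_le_iff, intro abs_count_minus_expansion_le) auto
      also have "\<dots> = (1 + 2 ^ (2 * r)) * (\<Sum>k\<le>r. real (((2 * n) choose (2 * k)) *
          (card (GEM D (2 * k)) * split_count D (2 * (n - k)) (2 * (r - k)))))"
        by (simp only: of_int_mult of_int_of_nat_eq of_nat_sum) simp
      also have "\<dots> \<le> (1 + 2 ^ (2 * r)) * (\<Sum>k\<le>r. K k * (gem_scale D (Suc r) n * ?a))"
        using elim assms(1) unfolding K_def
        by (intro mult_left_mono sum_mono choose_mult_split_count_le) auto
      also have "\<dots> = ((1 + 2 ^ (2 * r)) * (\<Sum>k\<le>r. K k)) * gem_scale D (Suc r) n * ?a"
        by (simp only: sum_distrib_right[symmetric] mult.assoc)
      finally have "\<bar>real (card {g\<in>GEM D (2 * n). \<pi>\<^sub>0 g = m}) - of_int (?S n)\<bar> / ?a \<le>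
          ((1 + 2 ^ (2 * r)) * (\<Sum>k\<le>r. K k)) * gem_scale D (Suc r) n"
        using a by (simp only: pos_divide_le_eq)
      then show ?case
        unfolding prob_GEM S diff_divide_distrib[symmetric] real_norm_def abs_divide
        using a gem_scale_nonneg[of D "Suc r" n] by (simp only: abs_of_pos abs_of_nonneg)
    qed
  qed
qed (rule gem_scale_Suc_smallo[OF assms(1)])

end
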